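(* Let $d$ be an even integer. For $k\ge 1$ let $\mathcal{S}_k^{\mathrm{left}}$ denote the set of sequences $(s_1,\dots,s_k)$ with entries in $\{\mathrm{left},\mathrm{right}\}$ and $s_1=\mathrm{left}$. For each integer $m\ge 2$ define $$U_{2m+1}^{(0)}:=U_{2m+1}(\emptyset),\qquad U_{2m+1}^{(k)}:=2\sum_{S\in\mathcal{S}_k^{\mathrm{left}}}U_{2m+1}(S)\quad(k=1,\dots,m-2),$$ and $$U_{2m+1}:=\sum_{k=0}^{m-2}U_{2m+1}^{(k)}=U_{2m+1}(\emptyset)+2\sum_{k=1}^{m-2}\ \sum_{S\in\mathcal{S}_k^{\mathrm{left}}}U_{2m+1}(S).$$ Then, in $\mathsf{GC}_d$, with $\partial$ the edge-contraction differential, $$W_{2m+1}+\partial(U_{2m+1})=2\sum_{S\in\mathcal{S}_{m-1}^{\mathrm{left}}}V_{2m+1}(S).$$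
   Context: **Kontsevich graph complex, $d$ even.** Work over a field of characteristic $0$. For $d$ even, $\mathsf{GC}_d$ is the vector space spanned by finite connected graphs without loops (edges joining a vertex to itself), all of whose vertices have valence at least $3$, equipped with a bijective labelling of the $E$ edges by $0,1,\dots,E-1$. These are taken modulo the relation that if $\phi:\Gamma\to\Gamma'$ is an isomorphism of the underlying graphs inducing the permutation $\sigma$ of edge labels, then $\Gamma=\operatorname{sgn}(\sigma)\,\Gamma'$. Vertex labels and edge directions do not matter. In particular a graph with a multiple edge is $0$. (The homological grading plays no role here.) **Differential.** $\partial\Gamma$ is the sum over all edges of $\Gamma$ of the graph obtained by contracting that edge; in a graph with $E$ edges (labelled $0,\dots,E-1$), contraction of the edge labelled $i$ carries the sign $(-1)^{i+E-1}$, so that contracting the last edge has sign $+1$. The remaining edges are relabelled preserving their relative order (labels larger than $i$ drop by $1$). Contractions producing a multiple edge or a loop contribute $0$. **The graphs $V_N(S)$ and $U_N(S)$.** Let $N$ be odd and let $S=(s_1,\dots,s_k)$, $k\ge 0$, be a sequence with $s_i\in\{\mathrm{left},\mathrm{right}\}$ ($S=\emptyset$ if $k=0$), with $2k+3\le N$ (and $2k+3<N$ for $U_N(S)$). Vertices are labelled from $0$, each newly added vertex receiving the next unused label. 1. Start with vertices $0,1,2,3$ and edges $(0,1),(0,2),(0,3),(1,2),(2,3)$, labelled $0,1,2,3,4$ in this order. Set $L=1$, $C=2$, $R=3$ ("current left, centre, right vertices"). 2. For $i=1,\dots,k$: let $X=R$ if $s_i=\mathrm{right}$ and $X=L$ if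 $s_i=\mathrm{left}$. Add a new vertex $C'$ and the edge $(C,C')$ with label $4i+1$; add the edge $(C',X)$ with label $4i+2$; add a second new vertex $X'$ and the edge $(X,X')$ with label $4i+3$; add the edge $(C',X')$ with label $4i+4$. Then replace $C$ by $C'$, and replace $R$ by $X'$ if $s_i=\mathrm{right}$, respectively $L$ by $X'$ if $s_i=\mathrm{left}$ (the other of $L,R$ is unchanged). 3. (Only for $U_N(S)$.) Add a new vertex $C'$ and the edge $(C,C')$ with label $4k+5$, and replace $C$ by $C'$. 4. Let $r=N-2k-3$, let $n$ be the current largest vertex label, and let $e=4k+5$ for $V_N(S)$, $e=4k+6$ for $U_N(S)$. If $r=0$ (only for $V_N(S)$), add the edge $(L,R)$ with label $2N-1$. If $r\ge 1$, add vertices $n+1,\dots,n+r$ and: the edge $(L,n+1)$ with label $e$ and $(n+1,C)$ with label $e+1$; for $i=1,\dots,r-1$, the edge $(n+i,n+i+1)$ with label $e+2i$ and $(n+i+1,C)$ with label $e+2i+1$; finally the edge $(n+r,R)$ with label $2N-1$ for $V_N(S)$ and $2N$ for $U_N(S)$. Thus $V_N(S)$ has $N+1$ vertices and $2N$ edges; $U_N(S)$ has $N+2$ vertices and $2N+1$ edges. **Wheel.** $W_N$ is the wheel graph with $N$ spokes: a cycle on $N$ rim vertices together with a hub vertex joined to each rim vertex. Its edge ordering (sign) is the one for which $W_N=V_N(\emptyset)$; the underlying graph of $V_N(\emptyset)$ is the wheel with hub vertex $2$. *)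

theory Defs
  imports Complex_Main "HOL-Library.Poly_Mapping" "HOL-Combinatorics.Permutations"
begin

section \<open>Edge-labelled graphs\<close>

text \<open>
  A finite graph, possibly with multiple edges, whose \<open>E\<close> edges are labelled by
  \<open>0, \<dots>, E - 1\<close>: the edge with label \<open>i\<close> is \<open>edges G ! i\<close>, given as the set of its end
  points. Taking the vertices in the natural numbers loses nothing, since graphs are
  considered up to isomorphism.
\<close>

datatype lgraph = LGraph (verts: "nat set") (edges: "nat set list")

abbreviation num_edges :: "lgraph \<Rightarrow> nat" where
  "num_edges G \<equiv> length (edges G)"

definition loopless_graph :: "lgraph \<Rightarrow> bool" where
  "loopless_graph G \<longleftrightarrow> finite (verts G) \<and> (\<forall>e\<in>set (edges G). e \<subseteq> verts G \<and> card e = 2)"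

definition adjacency :: "nat set list \<Rightarrow> (nat \<times> nat) set" where
  "adjacency es = {(u, v). {u, v} \<in> set es}"

definition graph_connected :: "lgraph \<Rightarrow> bool" where
  "graph_connected G \<longleftrightarrow> verts G \<noteq> {} \<and>
     (\<forall>u\<in>verts G. \<forall>v\<in>verts G. (u, v) \<in> (adjacency (edges G))\<^sup>*)"

definition valence :: "lgraph \<Rightarrow> nat \<Rightarrow> nat" where
  "valence G v = length (filter (\<lambda>e. v \<in> e) (edges G))"

definition admissible :: "lgraph \<Rightarrow> bool" where
  "admissible G \<longleftrightarrow> loopless_graph G \<and> graph_connected G \<and> (\<forall>v\<in>verts G. valence G v \<ge> 3)"

text \<open>
  An isomorphism is a pair of compatible bijections on vertices and on edge labels; with
  multiple edges the second is not determined by the first. In particular, exchanging two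
  parallel edges is an odd automorphism.
\<close>

definition graph_iso :: "(nat \<Rightarrow> nat) \<Rightarrow> (nat \<Rightarrow> nat) \<Rightarrow> lgraph \<Rightarrow> lgraph \<Rightarrow> bool" where
  "graph_iso f \<sigma> G G' \<longleftrightarrow>
     bij_betw f (verts G) (verts G') \<and> num_edges G = num_edges G' \<and>
     \<sigma> permutes {..<num_edges G} \<and>
     (\<forall>i<num_edges G. edges G' ! \<sigma> i = f ` (edges G ! i))"

text \<open>
  Contraction of the edge with label \<open>i\<close>: its larger end point is identified with the smaller
  one. Labels larger than \<open>i\<close> drop by 1, and edges parallel to it become singletons, i.e. loops.
\<close>

definition merge :: "nat set \<Rightarrow> nat \<Rightarrow> nat" where
  "merge e v = (if v = Max e then Min e else v)"

definition contract :: "lgraph \<Rightarrow> nat \<Rightarrow> lgraph" where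
  "contract G i = LGraph (verts G - {Max (edges G ! i)})
     (map (image (merge (edges G ! i))) (take i (edges G) @ drop (Suc i) (edges G)))"

definition no_loop_or_multi_edge :: "lgraph \<Rightarrow> bool" where
  "no_loop_or_multi_edge G \<longleftrightarrow> distinct (edges G) \<and> (\<forall>e\<in>set (edges G). card e = 2)"

lemma valence_ge_card:
  assumes "A \<subseteq> {e \<in> set (edges G). v \<in> e}" "card A \<ge> k"
  shows "valence G v \<ge> k"
proof -
  have "card A \<le> card (set (filter (\<lambda>e. v \<in> e) (edges G)))"
    by (rule card_mono) (use assms in auto)
  also have "\<dots> \<le> length (filter (\<lambda>e. v \<in> e) (edges G))"
    by (rule card_length)
  finally show ?thesis using assms(2) by (simp add: valence_def)
qed

lemma sym_adjacency: "sym (adjacency es)"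
  by (auto simp: sym_def adjacency_def insert_commute)

lemma connected_from_root:
  assumes "a \<in> verts G" "\<And>v. v \<in> verts G \<Longrightarrow> (a, v) \<in> (adjacency (edges G))\<^sup>*"
  shows "graph_connected G"
proof -
  have "(u, v) \<in> (adjacency (edges G))\<^sup>*" if "u \<in> verts G" "v \<in> verts G" for u v
    using assms(2)[OF that(2)] symD[OF sym_rtrancl[OF sym_adjacency] assms(2)[OF that(1)]]
    by (rule rtrancl_trans[rotated])
  then show ?thesis using assms(1) by (auto simp: graph_connected_def)
qed

section \<open>Contraction and isomorphisms\<close>

lemma contract_edge_facts:
  assumes "loopless_graph G" "i < num_edges G"
  obtains a b where "edges G ! i = {a, b}" "a < b" "a \<in> verts G" "b \<in> verts G"
    "Max (edges G ! i) = b" "Min (edges G ! i) = a"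
    "merge (edges G ! i) = (\<lambda>v. if v = b then a else v)"
proof -
  have "edges G ! i \<in> set (edges G)" using assms(2) by simp
  then have c: "card (edges G ! i) = 2" "edges G ! i \<subseteq> verts G"
    using assms(1) by (auto simp: loopless_graph_def)
  then obtain x y where xy: "edges G ! i = {x, y}" "x \<noteq> y" by (auto simp: card_2_iff)
  define a b where "a = min x y" and "b = max x y"
  have "edges G ! i = {a, b}" "a < b" using xy by (auto simp: a_def b_def min_def max_def)
  then show ?thesis using that[of a b] c(2) by (auto simp: merge_def fun_eq_iff)
qed

lemma split_edges:
  assumes "i < num_edges G"
  shows "edges G = take i (edges G) @ edges G ! i # drop (Suc i) (edges G)"
  using assms by (rule id_take_nth_drop)

lemma contract_admissible:
  assumes adm: "admissible G" and i: "i < num_edges G"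
    and nl: "\<forall>e\<in>set (edges (contract G i)). card e = 2"
  shows "admissible (contract G i)"
proof -
  have G: "loopless_graph G" using adm by (simp add: admissible_def)
  obtain a b where ab: "edges G ! i = {a, b}" "a < b" "a \<in> verts G" "b \<in> verts G"
    "Max (edges G ! i) = b" "Min (edges G ! i) = a"
    "merge (edges G ! i) = (\<lambda>v. if v = b then a else v)"
    using contract_edge_facts[OF G i] .
  define g where "g = (\<lambda>v. if v = b then a else v)"
  define os where "os = take i (edges G) @ drop (Suc i) (edges G)"
  have es: "set (edges G) = insert {a, b} (set os)"
    unfolding os_def by (subst split_edges[OF i]) (auto simp: ab)
  have c: "contract G i = LGraph (verts G - {b}) (map (image g) os)"
    unfolding contract_def ab(5,7) g_def os_def ..
  have ll: "loopless_graph (contract G i)"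
  proof -
    have "g ` e \<subseteq> verts G - {b}" if "e \<in> set os" for e
      using G es that ab(2,3) by (auto simp: loopless_graph_def g_def)
    then show ?thesis using G nl by (auto simp: loopless_graph_def c)
  qed
  have conn: "graph_connected (contract G i)"
  proof (rule connected_from_root)
    show "a \<in> verts (contract G i)" using ab by (simp add: c)
  next
    fix v assume v: "v \<in> verts (contract G i)"
    have "(a, v) \<in> (adjacency (edges G))\<^sup>*"
      using adm v ab by (auto simp: admissible_def graph_connected_def c)
    then have "(g a, g v) \<in> (adjacency (edges (contract G i)))\<^sup>*"
    proof induction
      case base then show ?case by simp
    next
      case (step y z)
      have "g y = g z \<or> (g y, g z) \<in> adjacency (edges (contract G i))"
      proof (cases "{y, z} = {a, b}")
        case True then show ?thesis by (auto simp: g_def doubleton_eq_iff)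
      next
        case False
        then have "{y, z} \<in> set os" using step(2) es by (auto simp: adjacency_def)
        then have "g ` {y, z} \<in> set (map (image g) os)" unfolding set_map by (rule imageI)
        then show ?thesis by (simp add: adjacency_def c)
      qed
      then show ?case using step(3) by auto
    qed
    then show "(a, v) \<in> (adjacency (edges (contract G i)))\<^sup>*"
      using v by (auto simp: g_def c split: if_splits)
  qed
  have val_eq: "valence G w = length (filter (\<lambda>e. w \<in> e) os) + (if w \<in> {a, b} then 1 else 0)" for w
    unfolding valence_def os_def by (subst split_edges[OF i]) (auto simp: ab)
  have "valence (contract G i) v \<ge> 3" if v: "v \<in> verts (contract G i)" for v
  proof (cases "v = a")
    case False
    have "v \<in> g ` e \<longleftrightarrow> v \<in> e" for e
      using False v by (auto simp: g_def c image_iff split: if_splits)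
    then have "valence (contract G i) v = length (filter (\<lambda>e. v \<in> e) os)"
      by (simp add: valence_def c filter_map o_def)
    also have "\<dots> = valence G v" using False v by (simp add: val_eq c)
    finally show ?thesis using adm v by (auto simp: admissible_def c)
  next
    case True
    have not_both: "\<not> (a \<in> e \<and> b \<in> e)" if "e \<in> set os" for e
    proof
      assume "a \<in> e \<and> b \<in> e"
      moreover have "card e = 2" using G es that by (auto simp: loopless_graph_def)
      ultimately have "e = {a, b}" using ab(2) by (auto simp: card_2_iff)
      then have "g ` e = {a}" by (auto simp: g_def)
      moreover have "card (g ` e) = 2" using nl that by (auto simp: c)
      ultimately show False by simp
    qed
    have "length (filter (\<lambda>e. a \<in> g ` e) xs) =
        length (filter (\<lambda>e. a \<in> e) xs) + length (filter (\<lambda>e. b \<in> e) xs)"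
      if "set xs \<subseteq> set os" for xs
      using that
    proof (induction xs)
      case Nil then show ?case by simp
    next
      case (Cons e xs)
      have "a \<in> g ` e \<longleftrightarrow> a \<in> e \<or> b \<in> e" using ab(2) by (auto simp: g_def image_iff)
      then show ?case using Cons not_both[of e] by auto
    qed
    then have "valence (contract G i) a =
        length (filter (\<lambda>e. a \<in> e) os) + length (filter (\<lambda>e. b \<in> e) os)"
      by (simp add: valence_def c filter_map o_def)
    moreover have "valence G a \<ge> 3" "valence G b \<ge> 3" using adm ab by (auto simp: admissible_def)
    ultimately show ?thesis using True by (simp add: val_eq)
  qed
  then show ?thesis using ll conn by (simp add: admissible_def)
qed

definition skip_last :: "nat \<Rightarrow> nat \<Rightarrow> nat \<Rightarrow> nat" where
  "skip_last E i j = (if j < i \<or> j \<ge> E then j else if j = E - 1 then i else Suc j)"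

lemma skip_last_props:
  assumes "i < E"
  shows "skip_last E i permutes {..<E} \<and> sign (skip_last E i) = (-1) ^ (i + E - 1)"
proof -
  have "i \<le> E - 1" using assms by simp
  then show ?thesis
  proof (induction rule: inc_induct)
    case base
    have "skip_last E (E - 1) = id" by (auto simp: skip_last_def fun_eq_iff)
    moreover have "E - 1 + E - 1 = 2 * (E - 1)" by simp
    ultimately show ?case by (simp add: permutes_def)
  next
    case (step n)
    have n: "Suc n < E" using step(1,2) by simp
    have eq: "skip_last E n = transpose n (Suc n) \<circ> skip_last E (Suc n)"
      using n by (auto simp: skip_last_def fun_eq_iff transpose_def)
    have t: "transpose n (Suc n) permutes {..<E}" using n by (intro permutes_swap_id) auto
    have p: "skip_last E (Suc n) permutes {..<E}" using step by blast
    have "sign (skip_last E n) = - ((-1) ^ (Suc n + E - 1))"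
      unfolding eq using step
      by (subst sign_compose) (auto simp: sign_swap_id intro: permutes_imp_permutation[OF _ p] permutes_imp_permutation[OF _ t])
    also have "\<dots> = (-1) ^ (n + E - 1)" using n by (cases E) auto
    finally show ?case using permutes_compose[OF p t, folded eq] by blast
  qed
qed

lemma nth_remove:
  assumes "i < length es" "j < length es - 1"
  shows "(take i es @ drop (Suc i) es) ! j = es ! skip_last (length es) i j"
proof (cases "j < i")
  case True then show ?thesis using assms by (auto simp: nth_append skip_last_def)
next
  case False
  then have "(take i es @ drop (Suc i) es) ! j = es ! (Suc i + (j - i))"
    using assms by (simp add: nth_append min_def)
  then show ?thesis using False assms
    by (cases "j = length es - 1") (auto simp: skip_last_def)
qed

lemma contract_iso:
  assumes iso: "graph_iso f \<sigma> G G'" and G: "loopless_graph G" and G': "loopless_graph G'"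
    and i: "i < num_edges G"
  obtains f' \<sigma>' where "graph_iso f' \<sigma>' (contract G i) (contract G' (\<sigma> i))"
    "sign \<sigma>' = (-1) ^ (i + num_edges G - 1) * sign \<sigma> * (-1) ^ (\<sigma> i + num_edges G - 1)"
proof -
  define E where "E = num_edges G"
  have E': "num_edges G' = E" and \<sigma>: "\<sigma> permutes {..<E}"
    and bij: "bij_betw f (verts G) (verts G')"
    and ed: "\<And>j. j < E \<Longrightarrow> edges G' ! \<sigma> j = f ` (edges G ! j)"
    using iso by (auto simp: graph_iso_def E_def)
  have iE: "i < E" and \<sigma>i: "\<sigma> i < E" using i \<sigma> permutes_in_image[OF \<sigma>, of i] by (auto simp: E_def)
  obtain a b where ab: "edges G ! i = {a, b}" "a < b" "a \<in> verts G" "b \<in> verts G"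
    "Max (edges G ! i) = b" "Min (edges G ! i) = a"
    "merge (edges G ! i) = (\<lambda>v. if v = b then a else v)"
    using contract_edge_facts[OF G i] .
  obtain a' b' where ab': "edges G' ! \<sigma> i = {a', b'}" "a' < b'" "a' \<in> verts G'" "b' \<in> verts G'"
    "Max (edges G' ! \<sigma> i) = b'" "Min (edges G' ! \<sigma> i) = a'"
    "merge (edges G' ! \<sigma> i) = (\<lambda>v. if v = b' then a' else v)"
    using contract_edge_facts[OF G' \<sigma>i[folded E']] .
  define g where "g = (\<lambda>v. if v = b then a else v)"
  define g' where "g' = (\<lambda>v. if v = b' then a' else v)"
  have fab: "{f a, f b} = {a', b'}" using ed[OF iE] ab(1) ab'(1) by simp
  have inj: "inj_on f (verts G)" using bij by (simp add: bij_betw_def)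
  have img: "f ` verts G = verts G'" using bij by (simp add: bij_betw_def)
  have fne: "f v \<noteq> f w" if "v \<in> verts G" "w \<in> verts G" "v \<noteq> w" for v w
    using inj that by (auto simp: inj_on_def)
  have comm: "g' (f (g v)) = g' (f v)" for v
    using fab by (auto simp: g_def g'_def doubleton_eq_iff)
  define f' where "f' = g' \<circ> f"
  have fa: "f' a = a'" using fab by (auto simp: f'_def g'_def doubleton_eq_iff)
  have f_other: "f' v = f v" "f v \<noteq> a'" "f v \<noteq> b'" if "v \<in> verts G" "v \<noteq> a" "v \<noteq> b" for v
    using fne[OF that(1) ab(3)] fne[OF that(1) ab(4)] that fab
    by (auto simp: f'_def g'_def doubleton_eq_iff)
  have bij': "bij_betw f' (verts G - {b}) (verts G' - {b'})"
    unfolding bij_betw_def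
  proof
    show "inj_on f' (verts G - {b})"
    proof (rule inj_onI)
      fix x y assume xy: "x \<in> verts G - {b}" "y \<in> verts G - {b}" "f' x = f' y"
      show "x = y"
      proof (cases "x = a"; cases "y = a")
        assume "x \<noteq> a" "y \<noteq> a"
        then show ?thesis using xy f_other(1)[of x] f_other(1)[of y] fne[of x y] by auto
      qed (use xy fa f_other[of x] f_other[of y] in auto)
    qed
    show "f' ` (verts G - {b}) = verts G' - {b'}"
    proof (intro equalityI subsetI)
      fix y assume "y \<in> f' ` (verts G - {b})"
      then obtain x where x: "x \<in> verts G" "x \<noteq> b" "y = f' x" by auto
      show "y \<in> verts G' - {b'}"
        using x fa ab' f_other[of x] img by (cases "x = a") auto
    next
      fix y assume y: "y \<in> verts G' - {b'}"
      show "y \<in> f' ` (verts G - {b})"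
      proof (cases "y = a'")
        case True then show ?thesis using fa ab by (intro image_eqI[of _ _ a]) auto
      next
        case False
        obtain x where x: "x \<in> verts G" "y = f x" using y img by auto
        then have "x \<noteq> a" "x \<noteq> b" using False y fab by (auto simp: doubleton_eq_iff)
        then show ?thesis using x f_other(1)[of x] by (intro image_eqI[of _ _ x]) auto
      qed
    qed
  qed
  define \<sigma>' where "\<sigma>' = inv (skip_last E (\<sigma> i)) \<circ> \<sigma> \<circ> skip_last E i"
  have p1: "skip_last E i permutes {..<E}" and p2: "skip_last E (\<sigma> i) permutes {..<E}"
    and s1: "sign (skip_last E i) = (-1) ^ (i + E - 1)"
    and s2: "sign (skip_last E (\<sigma> i)) = (-1) ^ (\<sigma> i + E - 1)"
    using skip_last_props[OF iE] skip_last_props[OF \<sigma>i] by auto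
  have p\<sigma>': "\<sigma>' permutes {..<E}"
    unfolding \<sigma>'_def by (intro permutes_compose permutes_inv p1 p2 \<sigma>)
  have skip: "skip_last E (\<sigma> i) (\<sigma>' j) = \<sigma> (skip_last E i j)" for j
    unfolding \<sigma>'_def using permutes_inverses(1)[OF p2] by simp
  have last: "\<sigma>' (E - 1) = E - 1"
  proof -
    have "skip_last E i (E - 1) = i" using iE by (auto simp: skip_last_def)
    moreover have "skip_last E (\<sigma> i) (E - 1) = \<sigma> i" using \<sigma>i by (auto simp: skip_last_def)
    ultimately have "skip_last E (\<sigma> i) (\<sigma>' (E - 1)) = skip_last E (\<sigma> i) (E - 1)"
      using skip[of "E - 1"] by simp
    then show ?thesis using permutes_inj[OF p2] by (simp add: inj_eq)
  qed
  have sub: "{..<E} = insert (E - 1) {..<E - 1}" using iE by auto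
  have perm: "\<sigma>' permutes {..<E - 1}"
    by (rule permutes_superset[OF p\<sigma>']) (use last sub in auto)
  have sgn: "sign \<sigma>' = (-1) ^ (i + E - 1) * sign \<sigma> * (-1) ^ (\<sigma> i + E - 1)"
  proof -
    have q: "permutation (skip_last E i)" "permutation (skip_last E (\<sigma> i))" "permutation \<sigma>"
      using p1 p2 \<sigma> by (auto intro: permutes_imp_permutation[of "{..<E}"])
    show ?thesis unfolding \<sigma>'_def
      using q s1 s2 by (simp add: sign_compose sign_inverse permutation_compose permutation_inverse)
  qed
  have "graph_iso f' \<sigma>' (contract G i) (contract G' (\<sigma> i))"
    unfolding graph_iso_def
  proof (intro conjI allI impI)
    show "bij_betw f' (verts (contract G i)) (verts (contract G' (\<sigma> i)))"
      using bij' by (simp add: contract_def ab(5) ab'(5))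
    have len: "num_edges (contract G i) = E - 1" "num_edges (contract G' (\<sigma> i)) = E - 1"
      using iE \<sigma>i E' by (auto simp: contract_def E_def)
    then show "num_edges (contract G i) = num_edges (contract G' (\<sigma> i))" by simp
    show "\<sigma>' permutes {..<num_edges (contract G i)}" using perm len by simp
    fix j assume "j < num_edges (contract G i)"
    then have j: "j < E - 1" using len by simp
    then have \<sigma>j: "\<sigma>' j < E - 1" using permutes_in_image[OF perm, of j] by simp
    have sj: "skip_last E i j < E" using permutes_in_image[OF p1, of j] j by simp
    have 1: "edges (contract G i) ! j = g ` (edges G ! skip_last E i j)"
      using nth_remove[of i "edges G" j] j iE
      len(1)
      by (simp add: contract_def ab(7) del: map_append flip: g_def E_def)
    have 2: "edges (contract G' (\<sigma> i)) ! (\<sigma>' j) = g' ` (edges G' ! skip_last E (\<sigma> i) (\<sigma>' j))"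
      using nth_remove[of "\<sigma> i" "edges G'" "\<sigma>' j"] \<sigma>j \<sigma>i
      len(2)
      by (simp add: contract_def ab'(7) E' del: map_append flip: g'_def)
    show "edges (contract G' (\<sigma> i)) ! (\<sigma>' j) = f' ` (edges (contract G i) ! j)"
      unfolding 1 2 skip ed[OF sj] by (auto simp: f'_def image_image comm)
  qed
  then show ?thesis using that sgn by (simp add: E_def)
qed

lemma iso_simple:
  assumes iso: "graph_iso f \<sigma> G G'" and G: "\<forall>e\<in>set (edges G). e \<subseteq> verts G"
  shows "no_loop_or_multi_edge G \<longleftrightarrow> no_loop_or_multi_edge G'"
proof -
  define E where "E = num_edges G"
  have E': "num_edges G' = E" and \<sigma>: "\<sigma> permutes {..<E}"
    and inj: "inj_on f (verts G)"
    and ed: "\<And>j. j < E \<Longrightarrow> edges G' ! \<sigma> j = f ` (edges G ! j)"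
    using iso by (auto simp: graph_iso_def E_def bij_betw_def)
  have sub: "edges G ! j \<subseteq> verts G" if "j < E" for j using G that by (auto simp: E_def)
  have im: "\<sigma> ` {..<E} = {..<E}" using permutes_image[OF \<sigma>] .
  have all_iff: "(\<forall>j<E. P (\<sigma> j)) \<longleftrightarrow> (\<forall>j<E. P j)" for P
  proof -
    have "(\<forall>j\<in>\<sigma> ` {..<E}. P j) \<longleftrightarrow> (\<forall>j<E. P (\<sigma> j))" by auto
    then show ?thesis unfolding im by auto
  qed
  have card_eq: "(\<forall>e\<in>set (edges G). card e = 2) \<longleftrightarrow> (\<forall>e\<in>set (edges G'). card e = 2)"
  proof -
    have "(\<forall>e\<in>set (edges G'). card e = 2) \<longleftrightarrow> (\<forall>j<E. card (edges G' ! j) = 2)"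
      using E' by (auto simp: all_set_conv_all_nth)
    also have "\<dots> \<longleftrightarrow> (\<forall>j<E. card (edges G' ! \<sigma> j) = 2)"
      using all_iff[of "\<lambda>j. card (edges G' ! j) = 2"] by simp
    also have "\<dots> \<longleftrightarrow> (\<forall>j<E. card (edges G ! j) = 2)"
      using ed sub inj by (auto simp: card_image inj_on_subset)
    finally show ?thesis by (auto simp: all_set_conv_all_nth E_def)
  qed
  have d: "distinct es \<longleftrightarrow> inj_on ((!) es) {..<length es}" for es :: "nat set list"
    by (auto simp: distinct_conv_nth inj_on_def)
  have "distinct (edges G') \<longleftrightarrow> inj_on ((!) (edges G')) (\<sigma> ` {..<E})"
    using d[of "edges G'"] E' im by simp
  also have "\<dots> \<longleftrightarrow> inj_on ((!) (edges G') \<circ> \<sigma>) {..<E}"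
    using comp_inj_on_iff[OF permutes_inj_on[OF \<sigma>, of "{..<E}"]] by blast
  also have "\<dots> \<longleftrightarrow> inj_on (\<lambda>j. f ` (edges G ! j)) {..<E}"
    by (rule inj_on_cong) (simp add: ed)
  also have "\<dots> \<longleftrightarrow> inj_on (\<lambda>j. edges G ! j) {..<E}"
    unfolding inj_on_def using inj_on_image_eq_iff[OF inj] sub by auto
  also have "\<dots> \<longleftrightarrow> distinct (edges G)" using d[of "edges G"] by (simp add: E_def)
  finally show ?thesis using card_eq by (simp add: no_loop_or_multi_edge_def)
qed

section \<open>The space \<open>GC\<^sub>d\<close> for even \<open>d\<close>\<close>

typedef gc_graph = "{G. admissible G}"
proof
  have "(u, v) \<in> (adjacency [{0, 1}, {0, 1}, {0, 1}])\<^sup>*" if "u < 2" "v < 2" for u v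
    using that by (cases "u = v") (auto intro!: r_into_rtrancl simp: adjacency_def doubleton_eq_iff less_2_cases_iff)
  then show "LGraph {0, 1} [{0, 1}, {0, 1}, {0, 1}] \<in> {G. admissible G}"
    by (auto simp: admissible_def loopless_graph_def graph_connected_def valence_def)
qed

definition free_scale :: "'k::field_char_0 \<Rightarrow> (gc_graph \<Rightarrow>\<^sub>0 'k) \<Rightarrow> (gc_graph \<Rightarrow>\<^sub>0 'k)" where
  "free_scale c x = Poly_Mapping.map ((*) c) x"

lemma lookup_free_scale: "Poly_Mapping.lookup (free_scale c x) G = c * Poly_Mapping.lookup x G"
  by (simp add: free_scale_def Poly_Mapping.map.rep_eq when_def)

global_interpretation free: vector_space free_scale
  by unfold_locales
    (auto simp: poly_mapping_eq_iff lookup_free_scale lookup_add algebra_simps fun_eq_iff)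

definition gc_relations :: "(gc_graph \<Rightarrow>\<^sub>0 'k::field_char_0) set" where
  "gc_relations = {Poly_Mapping.single G 1 - Poly_Mapping.single G' (of_int (sign \<sigma>)) | G G' f \<sigma>.
     graph_iso f \<sigma> (Rep_gc_graph G) (Rep_gc_graph G')}"

text \<open>
  The quotient of the free vector space on admissible labelled graphs by the span of the
  relations \<open>G = sgn \<sigma> \<cdot> G'\<close>. The homological grading, the only dependence on the even
  number \<open>d\<close>, is not recorded.
\<close>

quotient_type (overloaded) 'k gc = "gc_graph \<Rightarrow>\<^sub>0 'k::field_char_0" /
  "\<lambda>x y. x - y \<in> module.span free_scale gc_relations"
proof (rule equivpI)
  show "reflp (\<lambda>x y :: gc_graph \<Rightarrow>\<^sub>0 'k. x - y \<in> free.span gc_relations)"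
    by (auto simp: reflp_def free.span_zero)
  show "symp (\<lambda>x y :: gc_graph \<Rightarrow>\<^sub>0 'k. x - y \<in> free.span gc_relations)"
    by (auto simp: symp_def dest: free.span_neg)
  show "transp (\<lambda>x y :: gc_graph \<Rightarrow>\<^sub>0 'k. x - y \<in> free.span gc_relations)"
    by (auto simp: transp_def dest: free.span_add)
qed

instantiation gc :: (field_char_0) ab_group_add
begin

lift_definition zero_gc :: "'a gc" is 0 .

lift_definition plus_gc :: "'a gc \<Rightarrow> 'a gc \<Rightarrow> 'a gc" is "(+)"
  by (simp add: add_diff_add free.span_add)

lift_definition minus_gc :: "'a gc \<Rightarrow> 'a gc \<Rightarrow> 'a gc" is "(-)"
proof -
  fix x y x' y' :: "gc_graph \<Rightarrow>\<^sub>0 'a"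
  assume "x - y \<in> free.span gc_relations" "x' - y' \<in> free.span gc_relations"
  then have "(x - y) - (x' - y') \<in> free.span gc_relations" by (rule free.span_diff)
  then show "(x - x') - (y - y') \<in> free.span gc_relations" by (simp add: algebra_simps)
qed

lift_definition uminus_gc :: "'a gc \<Rightarrow> 'a gc" is uminus
  by (drule free.span_neg) simp

instance
  by standard (transfer; simp add: algebra_simps free.span_zero)+

end

lift_definition gc_scale :: "'k::field_char_0 \<Rightarrow> 'k gc \<Rightarrow> 'k gc" (infixr "*\<^sub>G" 75) is free_scale
  by (simp add: free.span_scale flip: free.scale_right_diff_distrib)

global_interpretation gc: vector_space gc_scale
  by unfold_locales (transfer; simp add: algebra_simps free.span_zero free.scale_right_distrib free.scale_left_distrib)+

text \<open>The element represented by a labelled graph; meaningful for admissible graphs only.\<close>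

definition gc_class :: "lgraph \<Rightarrow> 'k::field_char_0 gc" where
  "gc_class G = abs_gc (Poly_Mapping.single (Abs_gc_graph G) 1)"

section \<open>The differential\<close>

definition boundary_graph :: "gc_graph \<Rightarrow> (gc_graph \<Rightarrow>\<^sub>0 'k::field_char_0)" where
  "boundary_graph \<Gamma> = (let G = Rep_gc_graph \<Gamma>; E = num_edges G in
     \<Sum>i<E. if no_loop_or_multi_edge (contract G i)
       then Poly_Mapping.single (Abs_gc_graph (contract G i)) ((-1) ^ (i + E - 1)) else 0)"

definition boundary_free :: "(gc_graph \<Rightarrow>\<^sub>0 'k::field_char_0) \<Rightarrow> (gc_graph \<Rightarrow>\<^sub>0 'k)" where
  "boundary_free x =
     (\<Sum>\<Gamma>\<in>Poly_Mapping.keys x. free_scale (Poly_Mapping.lookup x \<Gamma>) (boundary_graph \<Gamma>))"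

lemma boundary_free_superset:
  assumes "finite A" "Poly_Mapping.keys x \<subseteq> A"
  shows "boundary_free x = (\<Sum>\<Gamma>\<in>A. free_scale (Poly_Mapping.lookup x \<Gamma>) (boundary_graph \<Gamma>))"
  unfolding boundary_free_def
  by (rule sum.mono_neutral_left) (use assms in \<open>auto simp: in_keys_iff\<close>)

lemma boundary_free_add: "boundary_free (x + y) = boundary_free x + boundary_free y"
proof -
  let ?A = "Poly_Mapping.keys x \<union> Poly_Mapping.keys y"
  have "Poly_Mapping.keys (x + y) \<subseteq> ?A" by (rule Poly_Mapping.keys_add)
  then show ?thesis
    by (simp add: boundary_free_superset[of ?A] lookup_add free.scale_left_distrib sum.distrib)
qed

lemma boundary_free_scale: "boundary_free (free_scale c x) = free_scale c (boundary_free x)"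
proof -
  have "Poly_Mapping.keys (free_scale c x) \<subseteq> Poly_Mapping.keys x"
    by (auto simp: in_keys_iff lookup_free_scale)
  then show ?thesis
    by (simp add: boundary_free_superset[of "Poly_Mapping.keys x"] lookup_free_scale free.scale_sum_right)
qed

lemma boundary_free_minus: "boundary_free (x - y) = boundary_free x - boundary_free y"
  using boundary_free_add[of "x - y" y] by (simp add: algebra_simps)

lemma free_scale_single:
  "free_scale c (Poly_Mapping.single \<Gamma> b) = Poly_Mapping.single \<Gamma> (c * b)"
  by (simp add: poly_mapping_eq_iff lookup_free_scale lookup_single fun_eq_iff when_def)

lemma boundary_free_single:
  "boundary_free (Poly_Mapping.single \<Gamma> c) = free_scale c (boundary_graph \<Gamma>)"
  by (subst boundary_free_superset[of "{\<Gamma>}"]) auto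

lemma boundary_relation:
  assumes iso: "graph_iso f \<sigma> (Rep_gc_graph \<Gamma>) (Rep_gc_graph \<Gamma>')"
  shows "boundary_graph \<Gamma> - free_scale (of_int (sign \<sigma>)) (boundary_graph \<Gamma>')
    \<in> free.span (gc_relations :: (gc_graph \<Rightarrow>\<^sub>0 'k::field_char_0) set)"
proof -
  define G where "G = Rep_gc_graph \<Gamma>"
  define G' where "G' = Rep_gc_graph \<Gamma>'"
  define E where "E = num_edges G"
  define t :: "lgraph \<Rightarrow> nat \<Rightarrow> gc_graph \<Rightarrow>\<^sub>0 'k" where
    "t = (\<lambda>G i. if no_loop_or_multi_edge (contract G i)
       then Poly_Mapping.single (Abs_gc_graph (contract G i)) ((-1) ^ (i + E - 1)) else 0)"
  have adm: "admissible G" "admissible G'"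
    using Rep_gc_graph[of \<Gamma>] Rep_gc_graph[of \<Gamma>'] by (auto simp: G_def G'_def)
  then have ll: "loopless_graph G" "loopless_graph G'" by (auto simp: admissible_def)
  have iso: "graph_iso f \<sigma> G G'" using iso by (simp add: G_def G'_def)
  then have \<sigma>: "\<sigma> permutes {..<E}" and E': "num_edges G' = E"
    by (auto simp: graph_iso_def E_def)
  have b1: "boundary_graph \<Gamma> = (\<Sum>i<E. t G i)"
    unfolding boundary_graph_def Let_def t_def G_def[symmetric] E_def[symmetric] ..
  have "boundary_graph \<Gamma>' = (\<Sum>i<E. t G' i)"
    unfolding boundary_graph_def Let_def t_def G'_def[symmetric] E' ..
  also have "\<dots> = (\<Sum>i<E. t G' (\<sigma> i))"
    using sum.permute[OF \<sigma>, of "t G'"] by (simp add: o_def)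
  finally have "boundary_graph \<Gamma> - free_scale (of_int (sign \<sigma>)) (boundary_graph \<Gamma>') =
      (\<Sum>i<E. t G i - free_scale (of_int (sign \<sigma>)) (t G' (\<sigma> i)))"
    by (simp add: b1 sum_subtractf free.scale_sum_right)
  also have "\<dots> \<in> free.span gc_relations"
  proof (rule free.span_sum)
    fix i assume "i \<in> {..<E}"
    then have i: "i < num_edges G" by (simp add: E_def)
    have \<sigma>i: "\<sigma> i < num_edges G'"
      using permutes_in_image[OF \<sigma>, of i] i E' by (simp add: E_def)
    obtain f' \<sigma>' where iso': "graph_iso f' \<sigma>' (contract G i) (contract G' (\<sigma> i))"
      and sgn: "sign \<sigma>' = (-1) ^ (i + E - 1) * sign \<sigma> * (-1) ^ (\<sigma> i + E - 1)"
      using contract_iso[OF iso ll i] unfolding E_def .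
    have "\<forall>e\<in>set (edges (contract G i)). e \<subseteq> verts (contract G i)"
    proof -
      obtain a b where ab: "a < b" "a \<in> verts G" "Max (edges G ! i) = b"
        "merge (edges G ! i) = (\<lambda>v. if v = b then a else v)"
        using contract_edge_facts[OF ll(1) i] by metis
      show ?thesis
        using ll(1) ab(1,2) unfolding contract_def ab(3,4) loopless_graph_def
        by (auto dest!: in_set_takeD in_set_dropD split: if_splits)
    qed
    then have simple: "no_loop_or_multi_edge (contract G i) \<longleftrightarrow> no_loop_or_multi_edge (contract G' (\<sigma> i))"
      by (rule iso_simple[OF iso'])
    show "t G i - free_scale (of_int (sign \<sigma>)) (t G' (\<sigma> i)) \<in> free.span gc_relations"
    proof (cases "no_loop_or_multi_edge (contract G i)")
      case False
      then show ?thesis using simple by (simp add: t_def free.span_zero)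
    next
      case True
      define D where "D = Abs_gc_graph (contract G i)"
      define D' where "D' = Abs_gc_graph (contract G' (\<sigma> i))"
      have "Rep_gc_graph D = contract G i" "Rep_gc_graph D' = contract G' (\<sigma> i)"
        using contract_admissible[OF adm(1) i] contract_admissible[OF adm(2) \<sigma>i] True simple
        by (auto simp: D_def D'_def Abs_gc_graph_inverse no_loop_or_multi_edge_def)
      then have rel: "Poly_Mapping.single D 1 - Poly_Mapping.single D' (of_int (sign \<sigma>')) \<in>
          (gc_relations :: (gc_graph \<Rightarrow>\<^sub>0 'k) set)"
        using iso' unfolding gc_relations_def by force
      have sq: "(-1) ^ n * ((-1) ^ n * x) = (x :: 'k)" for n x
        by (simp flip: mult.assoc power_mult_distrib)
      have "t G i - free_scale (of_int (sign \<sigma>)) (t G' (\<sigma> i)) =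
          free_scale ((-1) ^ (i + E - 1))
            (Poly_Mapping.single D 1 - Poly_Mapping.single D' (of_int (sign \<sigma>')))"
        using True simple
        by (simp add: t_def free.scale_right_diff_distrib free_scale_single sgn D_def D'_def
            mult.assoc sq)
      then show ?thesis using rel by (simp add: free.span_base free.span_scale)
    qed
  qed
  finally show ?thesis .
qed

lemma boundary_free_span:
  assumes "x \<in> free.span gc_relations"
  shows "boundary_free x \<in> free.span gc_relations"
  using assms
proof (induction rule: free.span_induct_alt)
  case base
  then show ?case by (simp add: boundary_free_def free.span_zero)
next
  case (step c x y)
  from step(1) obtain G G' f \<sigma> where
    x: "x = Poly_Mapping.single G 1 - Poly_Mapping.single G' (of_int (sign \<sigma>))"
    and iso: "graph_iso f \<sigma> (Rep_gc_graph G) (Rep_gc_graph G')"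
    unfolding gc_relations_def by blast
  have "boundary_free x \<in> free.span gc_relations"
    unfolding x boundary_free_minus boundary_free_single
    using boundary_relation[OF iso] by simp
  then show ?case
    using step by (simp add: boundary_free_add boundary_free_scale free.span_add free.span_scale)
qed

lift_definition gc_boundary :: "'k::field_char_0 gc \<Rightarrow> 'k gc" is boundary_free
  by (simp add: boundary_free_span flip: boundary_free_minus)

lemma gc_boundary_linear: "module_hom gc_scale gc_scale gc_boundary"
proof
  show "gc_boundary (x + y) = gc_boundary x + gc_boundary y" for x y :: "'a gc"
    by transfer (simp add: boundary_free_add free.span_zero)
  show "gc_boundary (c *\<^sub>G x) = c *\<^sub>G gc_boundary x" for c and x :: "'a gc"
    by transfer (simp add: boundary_free_scale free.span_zero)
qed

section \<open>The graphs \<open>V\<^sub>N(S)\<close> and \<open>U\<^sub>N(S)\<close>\<close>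

datatype side = Lft | Rgt

text \<open>
  A state \<open>(L, C, R, n, es)\<close> of the construction: current left, centre and right vertices,
  largest vertex label, and the list of edges so far. New edges are appended in the order of
  their labels, so the label of an edge is its position in the list.
\<close>

type_synonym build_state = "nat \<times> nat \<times> nat \<times> nat \<times> nat set list"

definition start_state :: build_state where
  "start_state = (1, 2, 3, 3, [{0,1}, {0,2}, {0,3}, {1,2}, {2,3}])"

fun add_side :: "side \<Rightarrow> build_state \<Rightarrow> build_state" where
  "add_side Rgt (L, C, R, n, es) =
     (L, n + 1, n + 2, n + 2, es @ [{C, n + 1}, {n + 1, R}, {R, n + 2}, {n + 1, n + 2}])"
| "add_side Lft (L, C, R, n, es) =
     (n + 2, n + 1, R, n + 2, es @ [{C, n + 1}, {n + 1, L}, {L, n + 2}, {n + 1, n + 2}])"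

fun add_centre :: "build_state \<Rightarrow> build_state" where
  "add_centre (L, C, R, n, es) = (L, n + 1, R, n + 1, es @ [{C, n + 1}])"

fun close_up :: "nat \<Rightarrow> build_state \<Rightarrow> lgraph" where
  "close_up r (L, C, R, n, es) =
     (if r = 0 then LGraph {0..n} (es @ [{L, R}])
      else LGraph {0..n + r}
        (es @ [{L, n + 1}, {n + 1, C}]
            @ concat (map (\<lambda>i. [{n + i, n + i + 1}, {n + i + 1, C}]) [1..<r])
            @ [{n + r, R}]))"

text \<open>Intended for odd \<open>N\<close> with \<open>2k + 3 \<le> N\<close>, respectively \<open>2k + 3 < N\<close>, where \<open>k = length S\<close>.\<close>

definition V_graph :: "nat \<Rightarrow> side list \<Rightarrow> lgraph" where
  "V_graph N S = close_up (N - 2 * length S - 3) (fold add_side S start_state)"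

definition U_graph :: "nat \<Rightarrow> side list \<Rightarrow> lgraph" where
  "U_graph N S = close_up (N - 2 * length S - 3) (add_centre (fold add_side S start_state))"

definition V_elt :: "nat \<Rightarrow> side list \<Rightarrow> 'k::field_char_0 gc" where
  "V_elt N S = gc_class (V_graph N S)"

definition U_elt :: "nat \<Rightarrow> side list \<Rightarrow> 'k::field_char_0 gc" where
  "U_elt N S = gc_class (U_graph N S)"

text \<open>These labelled graphs have the announced numbers of vertices and edges and are admissible.\<close>

definition state_ok :: "build_state \<Rightarrow> bool" where
  "state_ok = (\<lambda>(L, C, R, n, es).
     L \<le> n \<and> C \<le> n \<and> R \<le> n \<and> L \<noteq> C \<and> L \<noteq> R \<and> C \<noteq> R \<and>
     (\<forall>e\<in>set es. e \<subseteq> {0..n} \<and> card e = 2) \<and>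
     (\<forall>v\<le>n. (0, v) \<in> (adjacency es)\<^sup>*) \<and>
     (\<forall>v\<le>n. v \<noteq> C \<longrightarrow> (if v = L \<or> v = R then 2 else 3) \<le> length (filter (\<lambda>e. v \<in> e) es)))"

definition centre_valence :: "build_state \<Rightarrow> nat" where
  "centre_valence = (\<lambda>(L, C, R, n, es). length (filter (\<lambda>e. C \<in> e) es))"

lemma adjacency_append: "adjacency es \<subseteq> adjacency (es @ es')"
  by (auto simp: adjacency_def)

lemma reach_append: "(u, v) \<in> (adjacency es)\<^sup>* \<Longrightarrow> (u, v) \<in> (adjacency (es @ es'))\<^sup>*"
  using rtrancl_mono[OF adjacency_append] by blast

lemma reach_step:
  "(u, v) \<in> (adjacency es)\<^sup>* \<Longrightarrow> {v, w} \<in> set es \<Longrightarrow> (u, w) \<in> (adjacency es)\<^sup>*"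
  by (erule rtrancl_into_rtrancl) (simp add: adjacency_def)

lemma fresh_count:
  assumes "\<forall>e\<in>set es. e \<subseteq> {0..n} \<and> card e = 2" "(n::nat) < v"
  shows "filter (\<lambda>e. v \<in> e) es = []"
  using assms by (fastforce simp: filter_empty_conv)

lemma start_state_ok: "state_ok start_state" "centre_valence start_state = 3"
proof -
  have "(0, v) \<in> (adjacency [{0, 1}, {0, 2}, {0, 3}, {1, 2}, {2, 3}])\<^sup>*" if "v \<le> 3" for v
    using that by (cases "v = 0") (auto intro!: r_into_rtrancl simp: adjacency_def le_Suc_eq numeral_eq_Suc)
  then show "state_ok start_state"
    by (auto simp: state_ok_def start_state_def le_Suc_eq numeral_eq_Suc)
qed (simp add: centre_valence_def start_state_def)

lemma add_side_ok:
  assumes "state_ok st" "centre_valence st = 3 \<or> centre_valence st = 2"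
  shows "state_ok (add_side s st)" "centre_valence (add_side s st) = 3"
proof -
  obtain L C R n es where st: "st = (L, C, R, n, es)" by (metis prod_cases5)
  have ok: "L \<le> n" "C \<le> n" "R \<le> n" "L \<noteq> C" "L \<noteq> R" "C \<noteq> R"
    "\<forall>e\<in>set es. e \<subseteq> {0..n} \<and> card e = 2"
    "\<And>v. v \<le> n \<Longrightarrow> (0, v) \<in> (adjacency es)\<^sup>*"
    and val: "\<And>v. v \<le> n \<Longrightarrow> v \<noteq> C \<Longrightarrow>
      (if v = L \<or> v = R then 2 else 3) \<le> length (filter (\<lambda>e. v \<in> e) es)"
    using assms(1) by (auto simp: state_ok_def st)
  have C: "length (filter (\<lambda>e. C \<in> e) es) \<ge> 2" using assms(2) by (auto simp: centre_valence_def st)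
  define X where "X = (if s = Rgt then R else L)"
  define add where "add = [{C, n + 1}, {n + 1, X}, {X, n + 2}, {n + 1, n + 2}]"
  have X: "X \<le> n" "X \<noteq> C" using ok by (auto simp: X_def)
  have step: "add_side s st =
      (if s = Rgt then L else n + 2, n + 1, if s = Rgt then n + 2 else R, n + 2, es @ add)"
    by (cases s) (auto simp: st X_def add_def)
  have fresh: "filter (\<lambda>e. n + 1 \<in> e) es = []" "filter (\<lambda>e. n + 2 \<in> e) es = []"
    using fresh_count[OF ok(7)] by auto
  show "centre_valence (add_side s st) = 3"
    using ok X fresh by (simp add: step centre_valence_def add_def)
  have edges: "e \<subseteq> {0..n + 2} \<and> card e = 2" if "e \<in> set (es @ add)" for e
  proof (cases "e \<in> set es")
    case True then show ?thesis using ok(7) by force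
  next
    case False then show ?thesis using that ok(2) X by (auto simp: add_def card_insert_if)
  qed
  have old: "(0, v) \<in> (adjacency (es @ add))\<^sup>*" if "v \<le> n" for v
    using reach_append ok(8)[OF that] .
  have c1: "(0, n + 1) \<in> (adjacency (es @ add))\<^sup>*"
    by (rule reach_step[OF old[OF ok(2)]]) (simp add: add_def)
  have c2: "(0, n + 2) \<in> (adjacency (es @ add))\<^sup>*"
    by (rule reach_step[OF c1]) (simp add: add_def)
  have conn: "(0, v) \<in> (adjacency (es @ add))\<^sup>*" if v: "v \<le> n + 2" for v
  proof -
    consider "v \<le> n" | "v = n + 1" | "v = n + 2" using v by linarith
    then show ?thesis using old c1 c2 by cases auto
  qed
  have vals: "(if v = n + 2 \<or> v = L \<and> s = Rgt \<or> v = R \<and> s = Lft then 2 else 3)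
      \<le> length (filter (\<lambda>e. v \<in> e) (es @ add))" if v: "v \<le> n + 2" "v \<noteq> n + 1" for v
  proof -
    consider "v = n + 2" | "v \<le> n" "v = C" | "v \<le> n" "v = X" | "v \<le> n" "v \<noteq> C" "v \<noteq> X"
      using v by linarith
    then show ?thesis
    proof cases
      case 1 then show ?thesis by (simp add: add_def)
    next
      case 2 then show ?thesis using C by (simp add: add_def)
    next
      case 3 then show ?thesis using val[of v] X by (simp add: add_def split: if_splits)
    next
      case 4
      have "s = Rgt \<or> s = Lft" by (cases s) auto
      then show ?thesis using 4 val[of v] ok(5) by (auto simp: X_def split: if_splits)
    qed
  qed
  have s: "s \<noteq> Rgt \<longleftrightarrow> s = Lft" by (cases s) auto
  show "state_ok (add_side s st)"
    unfolding state_ok_def step prod.case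
  proof (intro conjI allI impI ballI)
    fix v assume v: "v \<le> n + 2" "v \<noteq> n + 1"
    show "(if v = (if s = Rgt then L else n + 2) \<or> v = (if s = Rgt then n + 2 else R) then 2 else 3)
      \<le> length (filter (\<lambda>e. v \<in> e) (es @ add))"
      using vals[OF v] s by (cases "s = Rgt") auto
  qed (use ok edges conn in \<open>auto split: if_splits\<close>)
qed

lemma fold_add_side_ok:
  "state_ok (fold add_side S start_state) \<and> centre_valence (fold add_side S start_state) = 3"
proof (induction S rule: rev_induct)
  case Nil then show ?case using start_state_ok by simp
next
  case (snoc s S) then show ?case using add_side_ok by simp
qed

lemma add_centre_ok:
  assumes "state_ok st" "centre_valence st = 3"
  shows "state_ok (add_centre st)" "centre_valence (add_centre st) = 1"
proof -
  obtain L C R n es where st: "st = (L, C, R, n, es)" by (metis prod_cases5)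
  have ok: "L \<le> n" "C \<le> n" "R \<le> n" "L \<noteq> C" "L \<noteq> R" "C \<noteq> R"
    "\<forall>e\<in>set es. e \<subseteq> {0..n} \<and> card e = 2"
    "\<And>v. v \<le> n \<Longrightarrow> (0, v) \<in> (adjacency es)\<^sup>*"
    and val: "\<And>v. v \<le> n \<Longrightarrow> v \<noteq> C \<Longrightarrow>
      (if v = L \<or> v = R then 2 else 3) \<le> length (filter (\<lambda>e. v \<in> e) es)"
    using assms(1) by (auto simp: state_ok_def st)
  have C: "length (filter (\<lambda>e. C \<in> e) es) = 3" using assms(2) by (auto simp: centre_valence_def st)
  show "centre_valence (add_centre st) = 1"
    using fresh_count[OF ok(7), of "n + 1"] by (simp add: st centre_valence_def)
  have edges: "e \<subseteq> {0..n + 1} \<and> card e = 2" if "e \<in> set (es @ [{C, n + 1}])" for e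
  proof (cases "e \<in> set es")
    case True then show ?thesis using ok(7) by force
  next
    case False then show ?thesis using that ok(2) by (auto simp: card_2_iff)
  qed
  have old: "(0, v) \<in> (adjacency (es @ [{C, n + 1}]))\<^sup>*" if "v \<le> n" for v
    using reach_append ok(8)[OF that] .
  have c1: "(0, n + 1) \<in> (adjacency (es @ [{C, n + 1}]))\<^sup>*"
    by (rule reach_step[OF old[OF ok(2)]]) simp
  have conn: "(0, v) \<in> (adjacency (es @ [{C, n + 1}]))\<^sup>*" if v: "v \<le> n + 1" for v
  proof -
    consider "v \<le> n" | "v = n + 1" using v by linarith
    then show ?thesis using old c1 by cases auto
  qed
  have vals: "(if v = L \<or> v = R then 2 else 3) \<le> length (filter (\<lambda>e. v \<in> e) (es @ [{C, n + 1}]))"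
    if v: "v \<le> n + 1" "v \<noteq> n + 1" for v
    using v val[of v] C ok(4,6) by (cases "v = C") auto
  show "state_ok (add_centre st)"
    unfolding state_ok_def st add_centre.simps prod.case
  proof (intro conjI allI impI ballI)
    fix v assume v: "v \<le> n + 1" "v \<noteq> n + 1"
    show "(if v = L \<or> v = R then 2 else 3) \<le> length (filter (\<lambda>e. v \<in> e) (es @ [{C, n + 1}]))"
      using vals[OF v] .
  qed (use ok edges conn in auto)
qed

lemma close_up_admissible:
  assumes "state_ok st" "centre_valence st + r \<ge> 3"
  shows "admissible (close_up r st)"
proof -
  obtain L C R n es where st: "st = (L, C, R, n, es)" by (metis prod_cases5)
  have ok: "L \<le> n" "C \<le> n" "R \<le> n" "L \<noteq> C" "L \<noteq> R" "C \<noteq> R"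
    "\<forall>e\<in>set es. e \<subseteq> {0..n} \<and> card e = 2"
    "\<And>v. v \<le> n \<Longrightarrow> (0, v) \<in> (adjacency es)\<^sup>*"
    and val: "\<And>v. v \<le> n \<Longrightarrow> v \<noteq> C \<Longrightarrow>
      (if v = L \<or> v = R then 2 else 3) \<le> length (filter (\<lambda>e. v \<in> e) es)"
    using assms(1) by (auto simp: state_ok_def st)
  have C: "length (filter (\<lambda>e. C \<in> e) es) + r \<ge> 3" using assms(2) by (auto simp: centre_valence_def st)
  show ?thesis
  proof (cases "r = 0")
    case True
    have "loopless_graph (close_up r st)"
      using True ok by (auto simp: st loopless_graph_def card_2_iff)
    moreover have "graph_connected (close_up r st)"
      by (rule connected_from_root[of 0]) (use True ok reach_append[OF ok(8)] in \<open>auto simp: st\<close>)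
    moreover have "valence (close_up r st) v \<ge> 3" if "v \<in> verts (close_up r st)" for v
      using that True C val[of v] ok(4,5,6)
      by (cases "v = C") (auto simp: st valence_def split: if_splits)
    ultimately show ?thesis by (simp add: admissible_def)
  next
    case False
    define mid where "mid = (\<lambda>r. concat (map (\<lambda>i. [{n + i, n + i + 1}, {n + i + 1, C}]) [1..<r]))"
    define es' where "es' = es @ [{L, n + 1}, {n + 1, C}] @ mid r @ [{n + r, R}]"
    have G: "close_up r st = LGraph {0..n + r} es'"
      using False by (simp add: st es'_def mid_def)
    have mid_set: "set (mid r) = (\<lambda>i. {n + i, n + i + 1}) ` {1..<r} \<union> (\<lambda>i. {n + i + 1, C}) ` {1..<r}"
      by (auto simp: mid_def)
    have mid_C: "length (filter (\<lambda>e. C \<in> e) (mid r)) \<ge> r - 1" for r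
      by (induction r) (auto simp: mid_def)
    have edges: "e \<subseteq> {0..n + r} \<and> card e = 2" if "e \<in> set es'" for e
    proof (cases "e \<in> set es")
      case True then show ?thesis using ok(7) by force
    next
      case e: False
      then have "e \<in> {{L, n + 1}, {n + 1, C}, {n + r, R}} \<union> set (mid r)" using that by (auto simp: es'_def)
      then show ?thesis using ok(1-3) False unfolding mid_set by (auto simp: card_insert_if)
    qed
    have spoke: "{n + j, C} \<in> set es'" if "1 \<le> j" "j \<le> r" for j
    proof (cases "j = 1")
      case True then show ?thesis by (simp add: es'_def)
    next
      case f: False
      then have "{n + j, C} \<in> (\<lambda>i. {n + i + 1, C}) ` {1..<r}"
        using that by (intro image_eqI[of _ _ "j - 1"]) auto
      then show ?thesis by (simp add: es'_def mid_set)
    qed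
    have path: "{n + i, n + i + 1} \<in> set es'" if "1 \<le> i" "i < r" for i
      using that by (auto simp: es'_def mid_set)
    have old: "(0, v) \<in> (adjacency es')\<^sup>*" if "v \<le> n" for v
      unfolding es'_def using reach_append ok(8)[OF that] .
    have conn: "(0, v) \<in> (adjacency es')\<^sup>*" if "v \<le> n + r" for v
    proof (cases "v \<le> n")
      case True then show ?thesis by (rule old)
    next
      case f: False
      have "{C, v} \<in> set es'" using spoke[of "v - n"] f that by (simp add: insert_commute)
      then show ?thesis by (rule reach_step[OF old[OF ok(2)]])
    qed
    have vals: "valence (close_up r st) v \<ge> 3" if "v \<le> n + r" for v
    proof (cases "v \<le> n")
      case True
      have "valence (close_up r st) v = length (filter (\<lambda>e. v \<in> e) es)
          + (if v = L \<or> v = n + 1 then 1 else 0) + (if v = n + 1 \<or> v = C then 1 else 0)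
          + length (filter (\<lambda>e. v \<in> e) (mid r)) + (if v = n + r \<or> v = R then 1 else 0)"
        by (simp add: valence_def G es'_def)
      then show ?thesis
        using True val[of v] C mid_C[of r] ok(4-6) False by (cases "v = C") (auto split: if_splits)
    next
      case f: False
      define j where "j = v - n"
      have j: "v = n + j" "1 \<le> j" "j \<le> r" using f that by (auto simp: j_def)
      define p where "p = (if j = 1 then L else n + j - 1)"
      define q where "q = (if j = r then R else n + j + 1)"
      have "{p, v} \<in> set es'"
        using path[of "j - 1"] j by (auto simp: p_def es'_def)
      moreover have "{v, q} \<in> set es'"
        using path[of j] j by (auto simp: q_def es'_def)
      moreover have "{v, C} \<in> set es'" using spoke j by simp
      moreover have "p \<noteq> q" "p \<noteq> C" "q \<noteq> C" using ok(1-6) j by (auto simp: p_def q_def)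
      ultimately show ?thesis
        by (intro valence_ge_card[of "{{p, v}, {v, q}, {v, C}}"])
          (auto simp: G doubleton_eq_iff card_insert_if)
    qed
    have "loopless_graph (close_up r st)" using edges by (auto simp: loopless_graph_def G)
    moreover have "graph_connected (close_up r st)"
      by (rule connected_from_root[of 0]) (use conn in \<open>auto simp: G\<close>)
    ultimately show ?thesis using vals by (auto simp: admissible_def G)
  qed
qed

lemma fold_add_side_size:
  assumes "fold add_side S start_state = (L, C, R, n, es)"
  shows "n = 2 * length S + 3 \<and> length es = 4 * length S + 5"
  using assms
proof (induction S arbitrary: L C R n es rule: rev_induct)
  case Nil then show ?case by (auto simp: start_state_def)
next
  case (snoc s S)
  obtain L' C' R' n' es' where "fold add_side S start_state = (L', C', R', n', es')"
    by (metis prod_cases5)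
  with snoc show ?case by (cases s) auto
qed

lemma close_up_size:
  "verts (close_up r (L, C, R, n, es)) = {0..n + r}"
  "num_edges (close_up r (L, C, R, n, es)) = length es + 2 * r + 1"
  by (auto simp: length_concat o_def sum_list_triv)

lemma V_graph_size:
  assumes "2 * length S + 3 \<le> N"
  shows "verts (V_graph N S) = {0..N}" "num_edges (V_graph N S) = 2 * N"
proof -
  obtain L C R n es where st: "fold add_side S start_state = (L, C, R, n, es)" by (metis prod_cases5)
  show "verts (V_graph N S) = {0..N}" "num_edges (V_graph N S) = 2 * N"
    unfolding V_graph_def st close_up_size using fold_add_side_size[OF st] assms by auto
qed

lemma U_graph_size:
  assumes "2 * length S + 3 < N"
  shows "verts (U_graph N S) = {0..N + 1}" "num_edges (U_graph N S) = 2 * N + 1"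
proof -
  obtain L C R n es where st: "fold add_side S start_state = (L, C, R, n, es)" by (metis prod_cases5)
  show "verts (U_graph N S) = {0..N + 1}" "num_edges (U_graph N S) = 2 * N + 1"
    unfolding U_graph_def st add_centre.simps close_up_size using fold_add_side_size[OF st] assms by auto
qed

lemma V_graph_admissible: "admissible (V_graph N S)"
  unfolding V_graph_def using fold_add_side_ok by (intro close_up_admissible) auto

lemma U_graph_admissible:
  assumes "odd N" "2 * length S + 3 < N"
  shows "admissible (U_graph N S)"
proof -
  have "N - 2 * length S - 3 \<ge> 2"
  proof (rule ccontr)
    assume "\<not> ?thesis"
    then have "N = 2 * length S + 4" using assms(2) by linarith
    then show False using assms(1) by simp
  qed
  then show ?thesis
    unfolding U_graph_def using add_centre_ok[of "fold add_side S start_state"] fold_add_side_ok[of S]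
    by (intro close_up_admissible) auto
qed

text \<open>
  The wheel \<open>W\<^sub>N\<close> carries, by convention, the edge ordering for which it equals \<open>V\<^sub>N(\<emptyset>)\<close>;
  the lemma confirms that the underlying graph is a wheel with hub \<open>2\<close>.
\<close>

definition is_wheel :: "nat \<Rightarrow> nat \<Rightarrow> lgraph \<Rightarrow> bool" where
  "is_wheel N h G \<longleftrightarrow> h \<in> verts G \<and> num_edges G = 2 * N \<and>
     (\<exists>rim. bij_betw rim {..<N} (verts G - {h}) \<and>
       set (edges G) = (\<lambda>i. {h, rim i}) ` {..<N} \<union> (\<lambda>i. {rim i, rim ((i + 1) mod N)}) ` {..<N})"

lemma V_graph_empty_is_wheel:
  assumes "N \<ge> 3"
  shows "is_wheel N 2 (V_graph N [])"
proof -
  define rim where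
    "rim = (\<lambda>i. if i = 0 then 0 else if i = 1 then 1 else if i = N - 1 then 3 else i + 2)"
  define W where "W = (\<lambda>i. {2, rim i}) ` {..<N} \<union> (\<lambda>i. {rim i, rim ((i + 1) mod N)}) ` {..<N}"
  have size: "verts (V_graph N []) = {0..N}" "num_edges (V_graph N []) = 2 * N"
    using V_graph_size[of "[]" N] assms by auto
  have inj: "inj_on rim {..<N}" by (auto simp: inj_on_def rim_def split: if_splits)
  have "rim ` {..<N} = {0..N} - {2}"
  proof (rule card_subset_eq)
    show "rim ` {..<N} \<subseteq> {0..N} - {2}" using assms by (auto simp: rim_def)
    show "card (rim ` {..<N}) = card ({0..N} - {2})"
      using card_image[OF inj] assms by (simp add: card_Diff_subset)
  qed simp
  then have bij: "bij_betw rim {..<N} (verts (V_graph N []) - {2})"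
    using inj by (simp add: bij_betw_def size)
  have spokeI: "{2, rim i} \<in> W" if "i < N" for i using that by (auto simp: W_def)
  have cycleI: "{rim i, rim (i + 1)} \<in> W" if "i + 1 < N" for i
    unfolding W_def using that by (intro UnI2 image_eqI[of _ _ i]) auto
  have lastI: "{rim (N - 1), rim 0} \<in> W"
    unfolding W_def using assms by (intro UnI2 image_eqI[of _ _ "N - 1"]) auto
  have rim_vals: "rim 0 = 0" "rim 1 = 1" "rim (Suc 0) = 1" "rim (N - 1) = 3"
    using assms by (auto simp: rim_def)
  have base: "{0, 1} \<in> W" "{0, 2} \<in> W" "{0, 3} \<in> W" "{1, 2} \<in> W" "{2, 3} \<in> W"
    using cycleI[of 0] spokeI[of 0] lastI spokeI[of 1] spokeI[of "N - 1"] assms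
    unfolding rim_vals by (simp_all add: rim_vals insert_commute)
  have W_D: "(\<exists>i<N. e = {2, rim i}) \<or> (\<exists>i. i + 1 < N \<and> e = {rim i, rim (i + 1)})
      \<or> e = {rim (N - 1), rim 0}" if "e \<in> W" for e
  proof -
    from that consider i where "i < N" "e = {2, rim i}" | i where "i < N" "e = {rim i, rim ((i + 1) mod N)}"
      by (auto simp: W_def)
    then show ?thesis
    proof cases
      case 1 then show ?thesis by blast
    next
      case 2
      show ?thesis
      proof (cases "i + 1 < N")
        case True then show ?thesis using 2 by auto
      next
        case False
        then have "i = N - 1" using 2 by simp
        then show ?thesis using 2 assms by simp
      qed
    qed
  qed
  have "set (edges (V_graph N [])) = W"
  proof (cases "N = 3")
    case True
    let ?T = "{{0, 1}, {0, 2}, {0, 3}, {1, 2}, {2, 3}, {1, 3}}"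
    have "{1, 3} \<in> W" using cycleI[of 1] True by (simp add: rim_def)
    then have "?T \<subseteq> W" using base by simp
    moreover have "W \<subseteq> ?T"
    proof -
      have lt: "{..<N} = {0, 1, 2}" using True by auto
      show ?thesis unfolding W_def lt using True by (simp add: rim_def doubleton_eq_iff)
    qed
    moreover have "set (edges (V_graph N [])) = ?T"
      using True by (auto simp: V_graph_def start_state_def)
    ultimately show ?thesis by (simp only: subset_antisym)
  next
    case False
    define r where "r = N - 3"
    have r: "r \<ge> 1" "N = r + 3" using assms False by (auto simp: r_def)
    have E: "set (edges (V_graph N [])) =
        {{0, 1}, {0, 2}, {0, 3}, {1, 2}, {2, 3}, {1, 4}, {4, 2}, {3 + r, 3}}
        \<union> (\<lambda>i. {3 + i, 3 + i + 1}) ` {1..<r} \<union> (\<lambda>i. {3 + i + 1, 2}) ` {1..<r}" (is "_ = ?E")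
    proof -
      have el: "edges (V_graph N []) = [{0, 1}, {0, 2}, {0, 3}, {1, 2}, {2, 3}] @ [{1, 4}, {4, 2}]
          @ concat (map (\<lambda>i. [{3 + i, 3 + i + 1}, {3 + i + 1, 2}]) [1..<r]) @ [{3 + r, 3}]"
        using r by (simp add: V_graph_def start_state_def)
      have cm: "set (concat (map (\<lambda>i. [a i, b i]) [1..<r])) = a ` {1..<r} \<union> b ` {1..<r}"
        for a b :: "nat \<Rightarrow> nat set" by auto
      have assoc: "set [a, b, c, d, e] \<union> (set [f, g] \<union> ((A \<union> B) \<union> set [h])) =
          {a, b, c, d, e, f, g, h} \<union> A \<union> B" for a b c d e f g h :: "nat set" and A B by auto
      show ?thesis unfolding el set_append cm by (rule assoc)
    qed
    have "?E \<subseteq> W"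
    proof -
      have ends: "{1, 4} \<in> W" "{4, 2} \<in> W" "{3 + r, 3} \<in> W"
      proof -
        have v: "rim (1 + 1) = 4" "rim 2 = 4" "rim (r + 1) = 3 + r" "rim (r + 1 + 1) = 3"
          using r by (auto simp: rim_def)
        show "{1, 4} \<in> W" using cycleI[of 1] r unfolding v rim_vals by simp
        show "{4, 2} \<in> W" using spokeI[of 2] r unfolding v by (simp add: insert_commute)
        show "{3 + r, 3} \<in> W" using cycleI[of "r + 1"] r unfolding v by simp
      qed
      moreover have "{3 + i, 3 + i + 1} \<in> W" "{3 + i + 1, 2} \<in> W" if "i \<in> {1..<r}" for i
      proof -
        have v: "rim (i + 1) = 3 + i" "rim (i + 1 + 1) = 3 + i + 1" "rim (i + 2) = 3 + i + 1"
          using r that by (auto simp: rim_def)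
        show "{3 + i, 3 + i + 1} \<in> W" using cycleI[of "i + 1"] r that unfolding v by simp
        show "{3 + i + 1, 2} \<in> W"
          using spokeI[of "i + 2"] r that unfolding v by (simp add: insert_commute)
      qed
      ultimately show ?thesis
        by (intro Un_least image_subsetI) (simp_all only: base insert_subset empty_subsetI)
    qed
    moreover have "W \<subseteq> ?E"
    proof
      fix e assume "e \<in> W"
      then consider i where "i < N" "e = {2, rim i}" | i where "i + 1 < N" "e = {rim i, rim (i + 1)}"
        | "e = {rim (N - 1), rim 0}"
        using W_D by blast
      then show "e \<in> ?E"
      proof cases
        case 1
        consider "i = 0" | "i = 1" | "i = N - 1" | "i = 2" "i < N - 1" | "3 \<le> i" "i < N - 1" using 1 by linarith
        then show ?thesis
        proof cases
          case 5
          then have "e \<in> (\<lambda>i. {3 + i + 1, 2}) ` {1..<r}"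
            using 1 r by (intro image_eqI[of _ _ "i - 2"]) (auto simp: rim_def)
          then show ?thesis by blast
        next
          case 1
          have "e = {0, 2}" unfolding \<open>e = {2, rim i}\<close> 1 rim_vals by (rule insert_commute)
          then show ?thesis by (intro UnI1) simp
        next
          case 2
          have "e = {1, 2}" unfolding \<open>e = {2, rim i}\<close> 2 rim_vals by (rule insert_commute)
          then show ?thesis by (intro UnI1) simp
        next
          case 3
          have "e = {2, 3}" unfolding \<open>e = {2, rim i}\<close> 3 rim_vals ..
          then show ?thesis by (intro UnI1) simp
        next
          case 4
          then have "rim i = 4" by (simp add: rim_def)
          then have "e = {4, 2}" unfolding \<open>e = {2, rim i}\<close> by (simp only: insert_commute)
          then show ?thesis by (intro UnI1) simp
        qed
      next
        case 2
        consider "i = 0" | "i = 1" | "i = N - 2" "2 \<le> i" | "2 \<le> i" "i < N - 2" using 2 by linarith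
        then show ?thesis
        proof cases
          case 4
          then have "e \<in> (\<lambda>i. {3 + i, 3 + i + 1}) ` {1..<r}"
            using 2 r by (intro image_eqI[of _ _ "i - 1"]) (auto simp: rim_def)
          then show ?thesis by blast
        next
          case 1
          then have "e = {0, 1}" using 2 by (simp add: rim_def)
          then show ?thesis by (intro UnI1) simp
        next
          case 2
          have v: "rim (1 + 1) = 4" using r by (simp add: rim_def)
          have "e = {1, 4}" unfolding \<open>e = {rim i, rim (i + 1)}\<close> 2 v rim_vals ..
          then show ?thesis by (intro UnI1) simp
        next
          case 3
          then have v: "rim i = 3 + r" "rim (i + 1) = 3" using r by (auto simp: rim_def)
          have "e = {3 + r, 3}" unfolding \<open>e = {rim i, rim (i + 1)}\<close> v ..
          then show ?thesis by (intro UnI1) simp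
        qed
      next
        case 3
        then have "e = {0, 3}" by (simp only: rim_vals insert_commute)
        then show ?thesis by (intro UnI1) simp
      qed
    qed
    ultimately show ?thesis unfolding E by (rule subset_antisym)
  qed
  then show ?thesis
    using bij size assms unfolding is_wheel_def W_def by auto
qed

definition W_elt :: "nat \<Rightarrow> 'k::field_char_0 gc" where
  "W_elt N = V_elt N []"

definition left_seqs :: "nat \<Rightarrow> side list set" where
  "left_seqs k = {S. length S = k \<and> k \<ge> 1 \<and> hd S = Lft}"

definition U_level :: "nat \<Rightarrow> nat \<Rightarrow> 'k::field_char_0 gc" where
  "U_level m k = (if k = 0 then U_elt (2 * m + 1) []
     else 2 *\<^sub>G (\<Sum>S\<in>left_seqs k. U_elt (2 * m + 1) S))"

definition U_total :: "nat \<Rightarrow> 'k::field_char_0 gc" where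
  "U_total m = (\<Sum>k = 0..m - 2. U_level m k)"

lemma finite_left_seqs: "finite (left_seqs k)"
proof -
  have "finite (UNIV :: side set)"
    by (rule finite_subset[of _ "{Lft, Rgt}"]) (use side.exhaust in auto)
  then have "finite {S :: side list. set S \<subseteq> UNIV \<and> length S = k}"
    by (rule finite_lists_length_eq)
  then show ?thesis by (rule rev_finite_subset) (auto simp: left_seqs_def)
qed

end

theory Submission
  imports Defs
begin

text \<open>
  Contracting an edge that lies in a triangle creates a double edge. Let \<open>k\<close> be the length of
  \<open>S\<close>. The edges of \<open>U\<^sub>N(S)\<close> in no triangle are: the one
  added in step 3, whose contraction gives \<open>-V\<^sub>N(S)\<close>; the first and the last edge of the
  path from \<open>L\<close> to \<open>R\<close>, whose contractions give \<open>V\<^sub>N(S, left)\<close> and \<open>V\<^sub>N(S, right)\<close>; and the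
  edges between consecutive centres \<open>C\<^sub>j\<close>, \<open>C\<^sub>j\<^sub>+\<^sub>1\<close> with \<open>s\<^sub>j \<noteq> s\<^sub>j\<^sub>+\<^sub>1\<close>. Contracting the
  latter gives the same graph for \<open>S\<close> and for \<open>S\<close> with \<open>s\<^sub>j\<close>, \<open>s\<^sub>j\<^sub>+\<^sub>1\<close> exchanged, except that
  two adjacent blocks of three edge labels are swapped, which is odd. These terms therefore cancel
  in the sum over all \<open>S\<close> of length \<open>k\<close>, whose boundary is the difference of the sums of
  \<open>V\<^sub>N\<close> over length \<open>k + 1\<close> and length \<open>k\<close>, and summing over \<open>k\<close> telescopes. For odd \<open>N\<close>
  the left-right reflection preserves \<open>U\<^sub>N\<close> and \<open>V\<^sub>N\<close> with sign \<open>+1\<close>, so that twice the sum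
  over \<open>s\<^sub>1 = left\<close> is the sum over all \<open>S\<close>.
\<close>

section \<open>Isomorphisms with a sign\<close>

text \<open>The class of a graph depends on an isomorphism only through the sign of its label
  permutation. With both maps hidden, isomorphisms are chained by multiplying signs.\<close>

definition signed_iso :: "int \<Rightarrow> lgraph \<Rightarrow> lgraph \<Rightarrow> bool" where
  "signed_iso s G G' \<longleftrightarrow> (\<exists>f \<sigma>. graph_iso f \<sigma> G G' \<and> sign \<sigma> = s)"

lemma signed_iso_trans:
  assumes "signed_iso s G G'" "signed_iso t G' G''"
  shows "signed_iso (s * t) G G''"
proof -
  obtain f \<sigma> g \<tau> where 1: "graph_iso f \<sigma> G G'" "sign \<sigma> = s" and 2: "graph_iso g \<tau> G' G''" "sign \<tau> = t"
    using assms by (auto simp: signed_iso_def)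
  have \<sigma>: "\<sigma> permutes {..<num_edges G}" and \<tau>: "\<tau> permutes {..<num_edges G}"
    using 1 2 by (auto simp: graph_iso_def)
  have "graph_iso (g \<circ> f) (\<tau> \<circ> \<sigma>) G G''"
    unfolding graph_iso_def
  proof (intro conjI allI impI)
    show "bij_betw (g \<circ> f) (verts G) (verts G'')"
      using 1 2 by (auto simp: graph_iso_def intro: bij_betw_trans)
    show "num_edges G = num_edges G''" using 1 2 by (auto simp: graph_iso_def)
    show "\<tau> \<circ> \<sigma> permutes {..<num_edges G}" by (rule permutes_compose[OF \<sigma> \<tau>])
    fix i assume "i < num_edges G"
    then show "edges G'' ! (\<tau> \<circ> \<sigma>) i = (g \<circ> f) ` (edges G ! i)"
      using 1 2 permutes_in_image[OF \<sigma>, of i] by (auto simp: graph_iso_def image_comp)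
  qed
  moreover have "sign (\<tau> \<circ> \<sigma>) = s * t"
    using 1 2 \<sigma> \<tau> by (subst sign_compose) (auto intro: permutes_imp_permutation[of "{..<num_edges G}"])
  ultimately show ?thesis by (auto simp: signed_iso_def)
qed

lemma signed_iso_relabel:
  assumes "inj_on f V"
  shows "signed_iso 1 (LGraph V es) (LGraph (f ` V) (map (image f) es))"
  unfolding signed_iso_def graph_iso_def
  using assms by (intro exI[of _ f] exI[of _ id]) (auto simp: bij_betw_def permutes_id)

lemma signed_iso_refl: "signed_iso 1 G G"
  using signed_iso_relabel[of id "verts G" "edges G"] by simp

lemma signed_iso_swap:
  "signed_iso (-1) (LGraph V (xs @ x # y # ys)) (LGraph V (xs @ y # x # ys))"
proof -
  let ?n = "length xs"
  have "transpose ?n (Suc ?n) permutes {..<length (xs @ x # y # ys)}"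
    by (rule permutes_swap_id) auto
  moreover have "(xs @ y # x # ys) ! transpose ?n (Suc ?n) i = (xs @ x # y # ys) ! i" for i
  proof -
    consider "i < ?n" | "i = ?n" | "i = Suc ?n" | "i > Suc ?n" by linarith
    then show ?thesis
      by cases (auto simp: nth_append transpose_def nth_Cons' not_less_eq)
  qed
  ultimately show ?thesis
    unfolding signed_iso_def graph_iso_def
    by (intro exI[of _ id] exI[of _ "transpose ?n (Suc ?n)"]) (auto simp: sign_swap_id)
qed

lemma signed_iso_move:
  "signed_iso ((-1) ^ length ys) (LGraph V (xs @ x # ys @ zs)) (LGraph V (xs @ ys @ x # zs))"
proof (induction ys arbitrary: xs)
  case Nil
  then show ?case using signed_iso_refl by simp
next
  case (Cons y ys)
  show ?case
    using signed_iso_trans[OF signed_iso_swap[of V xs x y "ys @ zs"] Cons.IH[of "xs @ [y]", unfolded append_assoc append.simps]]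
    by simp
qed

lemma signed_iso_swap_blocks:
  "signed_iso ((-1) ^ (length ys * length zs)) (LGraph V (xs @ ys @ zs @ ws)) (LGraph V (xs @ zs @ ys @ ws))"
proof (induction ys arbitrary: xs)
  case Nil
  then show ?case using signed_iso_refl by simp
next
  case (Cons y ys)
  show ?case
    using signed_iso_trans[OF Cons.IH[of "xs @ [y]", unfolded append_assoc append.simps]
        signed_iso_move[of zs V xs y "ys @ ws"]]
    by (simp add: power_add mult.commute)
qed

text \<open>The head passes the other \<open>n\<close> entries, then the tail is reversed in front
  of it; the exponents add up to the number of pairs of entries.\<close>

lemma signed_iso_rev:
  "signed_iso ((-1) ^ (length ys * (length ys - 1) div 2)) (LGraph V (xs @ ys @ zs)) (LGraph V (xs @ rev ys @ zs))"
proof (induction ys arbitrary: zs)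
  case Nil
  then show ?case using signed_iso_refl by simp
next
  case (Cons y ys)
  let ?n = "length ys"
  have "(length (y # ys) * (length (y # ys) - 1)) = ?n * (?n - 1) + 2 * ?n"
    by (cases ?n) auto
  then have "(length (y # ys) * (length (y # ys) - 1)) div 2 = ?n + ?n * (?n - 1) div 2"
    by simp
  then show ?case
    using signed_iso_trans[OF signed_iso_move[of ys V xs y zs] Cons.IH[of "y # zs"]]
    by (simp add: power_add)
qed

lemma signed_iso_no_loop_or_multi_edge:
  assumes "signed_iso s G G'" "\<forall>e\<in>set (edges G). e \<subseteq> verts G"
  shows "no_loop_or_multi_edge G \<longleftrightarrow> no_loop_or_multi_edge G'"
  using assms iso_simple unfolding signed_iso_def by blast

lemma gc_class_signed_iso:
  assumes "signed_iso s G G'" "admissible G" "admissible G'"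
  shows "gc_class G = of_int s *\<^sub>G (gc_class G' :: 'k::field_char_0 gc)"
proof -
  obtain f \<sigma> where iso: "graph_iso f \<sigma> G G'" and s: "sign \<sigma> = s"
    using assms(1) by (auto simp: signed_iso_def)
  have "Poly_Mapping.single (Abs_gc_graph G) 1 - Poly_Mapping.single (Abs_gc_graph G') (of_int s)
      \<in> (gc_relations :: (gc_graph \<Rightarrow>\<^sub>0 'k) set)"
    unfolding gc_relations_def s[symmetric]
    by (intro CollectI exI[of _ "Abs_gc_graph G"] exI[of _ "Abs_gc_graph G'"] exI[of _ f] exI[of _ \<sigma>])
      (use iso assms(2,3) in \<open>simp add: Abs_gc_graph_inverse\<close>)
  then have "Poly_Mapping.single (Abs_gc_graph G) 1 - free_scale (of_int s) (Poly_Mapping.single (Abs_gc_graph G') 1)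
      \<in> free.span (gc_relations :: (gc_graph \<Rightarrow>\<^sub>0 'k) set)"
    by (simp add: free_scale_single free.span_base)
  then show ?thesis
    unfolding gc_class_def gc_scale.abs_eq by (simp add: gc.abs_eq_iff)
qed

text \<open>The hypothesis gives \<open>2 *\<^sub>G x = 0\<close>, and 2 is invertible in
  characteristic 0.\<close>

lemma gc_eq_uminus_self:
  fixes x :: "'k::field_char_0 gc"
  assumes "x = - x"
  shows "x = 0"
proof -
  have "2 *\<^sub>G x = x + x" using gc.scale_left_distrib[of 1 1 x] by simp
  also have "\<dots> = 0" using assms by (metis add.right_inverse)
  finally show ?thesis using gc.scale_eq_0_iff[of 2 x] by simp
qed

text \<open>
  This makes it unnecessary to know whether the graphs \<open>V\<^sub>N(S)\<close> have multiple edges: a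
  contraction dropped for a multiple edge has class \<open>0\<close> anyway.
\<close>

lemma gc_class_multi_edge:
  assumes adm: "admissible G" and "\<not> distinct (edges G)"
  shows "gc_class G = (0 :: 'k::field_char_0 gc)"
proof -
  obtain i j where ij: "i < num_edges G" "j < num_edges G" "i \<noteq> j" "edges G ! i = edges G ! j"
    using assms(2) by (auto simp: distinct_conv_nth)
  have "edges G ! transpose i j l = edges G ! l" for l
    using ij by (auto simp: transpose_def)
  then have "graph_iso id (transpose i j) G G"
    using ij by (auto simp: graph_iso_def intro: permutes_swap_id)
  then have "signed_iso (-1) G G"
    using ij by (auto simp: signed_iso_def sign_swap_id intro!: exI)
  from gc_class_signed_iso[OF this adm adm] show ?thesis
    by (intro gc_eq_uminus_self) simp
qed

section \<open>Contractions\<close>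

text \<open>The unsigned summand of the differential. The guard is that of
  \<open>boundary_graph\<close>: a contraction with a loop is not admissible, so its
  \<open>gc_class\<close> has no meaning.\<close>

definition contracted_class :: "lgraph \<Rightarrow> nat \<Rightarrow> 'k::field_char_0 gc" where
  "contracted_class G i = (if no_loop_or_multi_edge (contract G i) then gc_class (contract G i) else 0)"

global_interpretation gc_boundary: module_hom gc_scale gc_scale gc_boundary
  by (rule gc_boundary_linear)

lemma abs_gc_sum: "abs_gc (\<Sum>i\<in>A. f i) = (\<Sum>i\<in>A. abs_gc (f i))"
  by (induction A rule: infinite_finite_induct) (auto simp: zero_gc_def simp flip: plus_gc.abs_eq)

lemma gc_boundary_class:
  assumes "admissible G"
  shows "gc_boundary (gc_class G :: 'k::field_char_0 gc) =
    (\<Sum>i<num_edges G. (-1) ^ (i + num_edges G - 1) *\<^sub>G contracted_class G i)"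
proof -
  have "gc_boundary (gc_class G :: 'k gc) = abs_gc (boundary_graph (Abs_gc_graph G))"
    unfolding gc_class_def gc_boundary.abs_eq by (simp add: boundary_free_single)
  then show ?thesis using assms
    by (auto simp: boundary_graph_def Let_def Abs_gc_graph_inverse abs_gc_sum contracted_class_def
        gc_class_def gc_scale.abs_eq free_scale_single zero_gc_def[symmetric] intro!: sum.cong)
qed

lemma contract_edges_subset:
  assumes "loopless_graph G" "i < num_edges G"
  shows "\<forall>e\<in>set (edges (contract G i)). e \<subseteq> verts (contract G i)"
proof -
  obtain a b where ab: "a < b" "a \<in> verts G" "Max (edges G ! i) = b"
    "merge (edges G ! i) = (\<lambda>v. if v = b then a else v)"
    using contract_edge_facts[OF assms] by metis
  show ?thesis
    using assms(1) ab(1,2) unfolding contract_def ab(3,4) loopless_graph_def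
    by (auto dest!: in_set_takeD in_set_dropD split: if_splits)
qed

text \<open>If the contraction is dropped, then \<open>H\<close> is not simple either; being
  admissible it has no loops, so it has a repeated edge and class 0. Thus the formula holds in both
  cases.\<close>

lemma contracted_class_signed_iso:
  assumes "signed_iso s (contract G i) H" "admissible G" "i < num_edges G" "admissible H"
  shows "contracted_class G i = of_int s *\<^sub>G (gc_class H :: 'k::field_char_0 gc)"
proof (cases "no_loop_or_multi_edge (contract G i)")
  case True
  then have "admissible (contract G i)"
    using assms contract_admissible by (auto simp: no_loop_or_multi_edge_def)
  then show ?thesis
    using True assms gc_class_signed_iso by (auto simp: contracted_class_def)
next
  case False
  have "\<not> no_loop_or_multi_edge H"
    using False signed_iso_no_loop_or_multi_edge[OF assms(1) contract_edges_subset] assms(2,3)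
    by (auto simp: admissible_def)
  then have "\<not> distinct (edges H)"
    using assms(4) by (auto simp: admissible_def loopless_graph_def no_loop_or_multi_edge_def)
  then show ?thesis
    using False by (simp add: contracted_class_def gc_class_multi_edge[OF assms(4)])
qed

text \<open>Compares two contractions, neither of them known to be admissible. Simplicity is
  invariant under isomorphism, so either both terms are dropped or the target is admissible.\<close>

lemma contracted_class_signed_iso_contract:
  assumes "signed_iso s (contract G i) (contract H j)" "admissible G" "i < num_edges G"
    "admissible H" "j < num_edges H"
  shows "contracted_class G i = of_int s *\<^sub>G (contracted_class H j :: 'k::field_char_0 gc)"
proof (cases "no_loop_or_multi_edge (contract H j)")
  case True
  then have "admissible (contract H j)"
    using assms contract_admissible by (auto simp: no_loop_or_multi_edge_def)
  then show ?thesis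
    using True contracted_class_signed_iso[OF assms(1-3)] by (simp add: contracted_class_def)
next
  case False
  then have "\<not> no_loop_or_multi_edge (contract G i)"
    using signed_iso_no_loop_or_multi_edge[OF assms(1) contract_edges_subset] assms(2,3)
    by (auto simp: admissible_def)
  then show ?thesis using False by (simp add: contracted_class_def)
qed

text \<open>\<open>contract\<close> always keeps the smaller end point. Since \<open>h\<close>
  agrees on both end points, it factors through \<open>merge\<close>, so any convenient quotient map
  can be used, with the order of the edges kept.\<close>

lemma contract_signed_iso:
  assumes V: "finite V" "a \<in> V" "b \<in> V" "a \<noteq> b"
    and h: "h a = h b" "inj_on h (V - {b})" "h ` V = V'"
  shows "signed_iso 1 (contract (LGraph V (xs @ {a, b} # ys)) (length xs)) (LGraph V' (map (image h) (xs @ ys)))"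
proof -
  let ?e = "{a, b}"
  have m: "h (merge ?e v) = h v" for v
    using h(1) V(4) by (auto simp: merge_def max_def min_def)
  have im: "h ` (V - {Max ?e}) = V'"
  proof -
    have "h (Max ?e) \<in> h ` (V - {Max ?e})"
      using V h(1) by (cases "a \<le> b") (auto simp: max_def intro: rev_image_eqI[of a] rev_image_eqI[of b])
    then show ?thesis using h(3) by blast
  qed
  have inj: "inj_on h (V - {Max ?e})"
  proof (cases "Max ?e = b")
    case False
    then have M: "Max ?e = a" by (auto simp: max_def)
    show ?thesis unfolding M
    proof (rule inj_onI)
      fix x y assume xy: "x \<in> V - {a}" "y \<in> V - {a}" "h x = h y"
      then show "x = y"
        using inj_onD[OF h(2), of x y] inj_onD[OF h(2), of a y] inj_onD[OF h(2), of x a] h(1) V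
        by (cases "x = b"; cases "y = b") auto
    qed
  qed (use h(2) in simp)
  have c: "contract (LGraph V (xs @ ?e # ys)) (length xs) =
      LGraph (V - {Max ?e}) (map (image (merge ?e)) (xs @ ys))"
    by (simp add: contract_def nth_append)
  show ?thesis
    using signed_iso_relabel[OF inj, of "map (image (merge ?e)) (xs @ ys)"] m
    unfolding c im by (simp add: o_def image_image)
qed

text \<open>The parameter is a set of edges, so that a triangle found in part of an edge list is
  also one in the whole list.\<close>

definition in_triangle :: "nat set set \<Rightarrow> nat set \<Rightarrow> bool" where
  "in_triangle X e \<longleftrightarrow> (\<exists>a b w. e = {a, b} \<and> a \<noteq> b \<and> w \<noteq> a \<and> w \<noteq> b \<and> {a, w} \<in> X \<and> {b, w} \<in> X)"

lemma in_triangleI: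
  assumes "e = {a, b}" "a \<noteq> b" "w \<noteq> a" "w \<noteq> b" "{a, w} \<in> X" "{b, w} \<in> X"
  shows "in_triangle X e"
  using assms unfolding in_triangle_def by blast

lemma in_triangle_mono: "in_triangle X e \<Longrightarrow> X \<subseteq> Y \<Longrightarrow> in_triangle Y e"
  unfolding in_triangle_def by blast

lemma contracted_class_triangle:
  assumes i: "i < num_edges G" and tri: "in_triangle (set (edges G)) (edges G ! i)"
  shows "contracted_class G i = 0"
proof -
  obtain a b w where e: "edges G ! i = {a, b}" "a \<noteq> b" "w \<noteq> a" "w \<noteq> b"
    and w: "{a, w} \<in> set (edges G)" "{b, w} \<in> set (edges G)"
    using tri by (auto simp: in_triangle_def)
  let ?os = "take i (edges G) @ drop (Suc i) (edges G)" and ?m = "merge {a, b}"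
  have es: "set (edges G) = insert {a, b} (set ?os)"
    by (subst split_edges[OF i]) (auto simp: e)
  have "{a, w} \<noteq> {a, b}" "{b, w} \<noteq> {a, b}" using e by (auto simp: doubleton_eq_iff)
  then have os: "{a, w} \<in> set ?os" "{b, w} \<in> set ?os" using w es by auto
  have "?m ` {a, w} = ?m ` {b, w}" using e by (auto simp: merge_def max_def min_def)
  moreover have "{a, w} \<noteq> {b, w}" using e by (auto simp: doubleton_eq_iff)
  ultimately have "\<not> inj_on (image ?m) (set ?os)" using os by (meson inj_onD)
  then have "\<not> distinct (edges (contract G i))"
    by (simp only: contract_def e lgraph.sel distinct_map) simp
  then show ?thesis by (simp add: contracted_class_def no_loop_or_multi_edge_def)
qed

section \<open>Recursive edge lists\<close>

text \<open>The closing path from \<open>L\<close> to \<open>R\<close> through the listed vertices,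
  each joined to \<open>C\<close> by a spoke. Path edges have even positions and spokes odd ones;
  the empty list covers the separate case \<open>r = 0\<close> of the construction.\<close>

fun fan :: "nat \<Rightarrow> nat \<Rightarrow> nat \<Rightarrow> nat list \<Rightarrow> nat set list" where
  "fan L C R [] = [{L, R}]"
| "fan L C R (x # xs) = {L, x} # {x, C} # fan x C R xs"

lemma length_fan [simp]: "length (fan L C R xs) = 2 * length xs + 1"
  by (induction xs arbitrary: L) auto

lemma map_image_fan: "map (image h) (fan L C R xs) = fan (h L) (h C) (h R) (map h xs)"
  by (induction xs arbitrary: L) auto

lemma fan_snoc: "fan L C R (xs @ [x]) = fan L C x xs @ [{x, C}, {x, R}]"
  by (induction xs arbitrary: L) auto

lemma rev_fan: "rev (fan L C R xs) = fan R C L (rev xs)"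
  by (induction xs arbitrary: L) (auto simp: fan_snoc insert_commute)

text \<open>The added edge \<open>{L, C}\<close> stands for the spoke at the preceding path vertex:
  it closes the triangle of the spoke \<open>{x, C}\<close>, and for the tail its role is taken by
  \<open>{x, C}\<close>. An inner path edge forms a triangle with the spokes at its ends.\<close>

lemma fan_in_triangle:
  assumes "distinct (L # C # xs)" "R \<notin> set (C # xs)" "i < 2 * length xs" "i \<noteq> 0"
  shows "in_triangle (insert {L, C} (set (fan L C R xs))) (fan L C R xs ! i)"
  using assms
proof (induction xs arbitrary: L i)
  case Nil
  then show ?case by simp
next
  case (Cons x xs)
  consider "i = 1" | "i = 2" "xs \<noteq> []" | j where "i = j + 2" "j < 2 * length xs" "j \<noteq> 0"
  proof -
    have "i = 1 \<or> i = 2 \<and> xs \<noteq> [] \<or> i = (i - 2) + 2 \<and> i - 2 < 2 * length xs \<and> i - 2 \<noteq> 0"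
      using Cons.prems(3,4) by (cases xs) auto
    then show ?thesis using that by blast
  qed
  then show ?case
  proof cases
    case 1
    then show ?thesis using Cons.prems by (intro in_triangleI[of _ x C L]) (auto simp: insert_commute)
  next
    case 2
    then obtain y ys where xs: "xs = y # ys" by (cases xs) auto
    have "in_triangle (insert {L, C} (set (fan L C R (x # xs)))) {x, y}"
      by (rule in_triangleI[of _ x y C]) (use Cons.prems(1) in \<open>auto simp: xs\<close>)
    then show ?thesis using 2 by (simp add: xs)
  next
    case 3
    have "in_triangle (insert {x, C} (set (fan x C R xs))) (fan x C R xs ! j)"
      by (rule Cons.IH) (use Cons.prems 3 in auto)
    then have "in_triangle (insert {L, C} (set (fan L C R (x # xs)))) (fan x C R xs ! j)"
      by (rule in_triangle_mono) auto
    then show ?thesis using 3 by simp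
  qed
qed

text \<open>
  The edges added from the state \<open>(L, C, R, n)\<close> on, where the last argument \<open>F\<close> supplies those
  after the sides of \<open>S\<close>.
\<close>

fun grow :: "(nat \<Rightarrow> nat \<Rightarrow> nat \<Rightarrow> nat \<Rightarrow> nat set list) \<Rightarrow> side list \<Rightarrow> nat \<Rightarrow> nat \<Rightarrow> nat \<Rightarrow> nat \<Rightarrow> nat set list"
  where
  "grow F [] L C R n = F L C R n"
| "grow F (Lft # S) L C R n = {C, n + 1} # {n + 1, L} # {L, n + 2} # {n + 1, n + 2} #
     grow F S (n + 2) (n + 1) R (n + 2)"
| "grow F (Rgt # S) L C R n = {C, n + 1} # {n + 1, R} # {R, n + 2} # {n + 1, n + 2} #
     grow F S L (n + 1) (n + 2) (n + 2)"

definition V_end :: "nat \<Rightarrow> nat \<Rightarrow> nat \<Rightarrow> nat \<Rightarrow> nat \<Rightarrow> nat set list" where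
  "V_end r L C R n = fan L C R [n + 1..<n + r + 1]"

definition U_end :: "nat \<Rightarrow> nat \<Rightarrow> nat \<Rightarrow> nat \<Rightarrow> nat \<Rightarrow> nat set list" where
  "U_end r L C R n = {C, n + 1} # V_end r L (n + 1) R (n + 1)"

definition start_edges :: "nat set list" where
  "start_edges = [{0, 1}, {0, 2}, {0, 3}, {1, 2}, {2, 3}]"

lemma close_up_fan: "close_up r (L, C, R, n, es) = LGraph {0..n + r} (es @ V_end r L C R n)"
proof (cases "r = 0")
  case False
  \<comment> \<open>Generalised to any first index \<open>a\<close>, so that the induction can run
    down from \<open>a = r\<close>.\<close>
  have "concat (map (\<lambda>i. [{n + i, n + i + 1}, {n + i + 1, C}]) [a..<r]) @ [{n + r, R}] =
      fan (n + a) C R [n + a + 1..<n + r + 1]" if "a \<le> r" for a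
    using that
  proof (induction rule: inc_induct)
    case (step a)
    then have "[n + a + 1..<n + r + 1] = (n + a + 1) # [n + Suc a + 1..<n + r + 1]"
      by (simp add: upt_conv_Cons)
    then show ?case using step by (simp add: upt_conv_Cons)
  qed simp
  from this[of 1] have "concat (map (\<lambda>i. [{n + i, n + i + 1}, {n + i + 1, C}]) [1..<r]) @ [{n + r, R}] =
      fan (n + 1) C R [n + 1 + 1..<n + r + 1]"
    using False by simp
  moreover have "[n + 1..<n + r + 1] = (n + 1) # [n + 1 + 1..<n + r + 1]"
    using False by (simp add: upt_conv_Cons del: upt_Suc)
  ultimately have "V_end r L C R n = {L, n + 1} # {n + 1, C} #
      concat (map (\<lambda>i. [{n + i, n + i + 1}, {n + i + 1, C}]) [1..<r]) @ [{n + r, R}]"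
    by (simp only: V_end_def fan.simps)
  then show ?thesis using False by simp
qed (simp add: V_end_def)

lemma close_up_fold:
  "close_up r (fold add_side S (L, C, R, n, es)) =
     LGraph {0..n + 2 * length S + r} (es @ grow (V_end r) S L C R n)"
proof (induction S arbitrary: L C R n es)
  case Nil
  then show ?case by (simp only: fold.simps id_apply close_up_fan grow.simps) simp
next
  case (Cons s S)
  then show ?case by (cases s) simp_all
qed

lemma close_up_centre_fold:
  "close_up r (add_centre (fold add_side S (L, C, R, n, es))) =
     LGraph {0..n + 2 * length S + r + 1} (es @ grow (U_end r) S L C R n)"
proof (induction S arbitrary: L C R n es)
  case Nil
  then show ?case by (simp only: fold.simps id_apply add_centre.simps close_up_fan U_end_def grow.simps) simp
next
  case (Cons s S)
  then show ?case by (cases s) simp_all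
qed

lemma V_graph_grow:
  assumes "2 * length S + 3 \<le> N"
  shows "V_graph N S = LGraph {0..N} (start_edges @ grow (V_end (N - 2 * length S - 3)) S 1 2 3 3)"
proof -
  have "3 + 2 * length S + (N - 2 * length S - 3) = N" using assms by simp
  then show ?thesis by (simp only: V_graph_def start_state_def close_up_fold start_edges_def)
qed

lemma U_graph_grow:
  assumes "2 * length S + 3 < N"
  shows "U_graph N S = LGraph {0..N + 1} (start_edges @ grow (U_end (N - 2 * length S - 3)) S 1 2 3 3)"
proof -
  have "3 + 2 * length S + (N - 2 * length S - 3) = N" using assms by simp
  then show ?thesis by (simp only: U_graph_def start_state_def close_up_centre_fold start_edges_def)
qed

section \<open>Splitting, relabelling and reflecting the recursive edge lists\<close>

lemma grow_append: "grow F (S @ T) L C R n = grow (grow F T) S L C R n"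
  by (induction F S L C R n rule: grow.induct) auto

lemma map_image_V_end:
  assumes "\<And>v. v > n \<Longrightarrow> h v = v"
  shows "map (image h) (V_end r L C R n) = V_end r (h L) (h C) (h R) n"
proof -
  have "map h [n + 1..<n + r + 1] = [n + 1..<n + r + 1]" using assms by (intro map_idI) auto
  then show ?thesis by (simp only: V_end_def map_image_fan)
qed

lemma map_image_U_end:
  assumes "\<And>v. v > n \<Longrightarrow> h v = v"
  shows "map (image h) (U_end r L C R n) = U_end r (h L) (h C) (h R) n"
  using assms by (simp add: U_end_def map_image_V_end)

text \<open>All vertices created later exceed \<open>n\<close>, so a map fixing these acts only on
  the current triple \<open>L\<close>, \<open>C\<close>, \<open>R\<close>.\<close>

lemma map_image_grow:
  assumes "\<And>v. v > n \<Longrightarrow> h v = v"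
    and "\<And>L C R k. n \<le> k \<Longrightarrow> map (image h) (F L C R k) = F (h L) (h C) (h R) k"
  shows "map (image h) (grow F S L C R n) = grow F S (h L) (h C) (h R) n"
  using assms by (induction F S L C R n rule: grow.induct) simp_all

fun flip :: "side \<Rightarrow> side" where
  "flip Lft = Rgt"
| "flip Rgt = Lft"

lemma flip_flip [simp]: "flip (flip s) = s"
  by (cases s) auto

text \<open>The edges of a step depend only on which vertex is chosen as \<open>X\<close>, so
  exchanging left and right throughout gives the very same list, vertex names and order
  included.\<close>

lemma grow_flip: "grow F S L C R n = grow (\<lambda>L C R. F R C L) (map flip S) R C L n"
  by (induction F S L C R n rule: grow.induct) auto

text \<open>The edges and the triple reached after \<open>S\<close> do not depend on
  \<open>F\<close>. Hence the same \<open>es\<close> occurs in \<open>U_N(S)\<close>,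
  \<open>V_N(S)\<close> and \<open>V_N(S, s)\<close>, and only the ends have to be compared.\<close>

lemma grow_decompose:
  assumes "L \<le> n" "C \<le> n" "R \<le> n" "distinct [L, C, R]"
  obtains es L' C' R' where
    "\<And>F. grow F S L C R n = es @ F L' C' R' (n + 2 * length S)"
    "L' \<le> n + 2 * length S" "C' \<le> n + 2 * length S" "R' \<le> n + 2 * length S" "distinct [L', C', R']"
    "length es = 4 * length S" "\<And>e. e \<in> set es \<Longrightarrow> e \<subseteq> {0..n + 2 * length S}"
  using assms
proof (induction S arbitrary: L C R n thesis)
  case Nil
  show ?case by (rule Nil.prems(1)[of "[]" L C R]) (use Nil.prems in auto)
next
  case (Cons s S)
  show ?case
  proof (cases s)
    case Lft
    obtain es L' C' R' where *:
      "\<And>F. grow F S (n + 2) (n + 1) R (n + 2) = es @ F L' C' R' ((n + 2) + 2 * length S)"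
      "L' \<le> n + 2 + 2 * length S" "C' \<le> n + 2 + 2 * length S" "R' \<le> n + 2 + 2 * length S"
      "distinct [L', C', R']"
      "length es = 4 * length S" "\<And>e. e \<in> set es \<Longrightarrow> e \<subseteq> {0..n + 2 + 2 * length S}"
      by (rule Cons.IH[of "n + 2" "n + 1" R "n + 2"]) (use Cons.prems in auto)
    show ?thesis
      by (rule Cons.prems(1)[of "{C, n + 1} # {n + 1, L} # {L, n + 2} # {n + 1, n + 2} # es" L' C' R'])
        (use * Cons.prems(2-) Lft in auto)
  next
    case Rgt
    obtain es L' C' R' where *:
      "\<And>F. grow F S L (n + 1) (n + 2) (n + 2) = es @ F L' C' R' ((n + 2) + 2 * length S)"
      "L' \<le> n + 2 + 2 * length S" "C' \<le> n + 2 + 2 * length S" "R' \<le> n + 2 + 2 * length S"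
      "distinct [L', C', R']"
      "length es = 4 * length S" "\<And>e. e \<in> set es \<Longrightarrow> e \<subseteq> {0..n + 2 + 2 * length S}"
      by (rule Cons.IH[of L "n + 1" "n + 2" "n + 2"]) (use Cons.prems in auto)
    show ?thesis
      by (rule Cons.prems(1)[of "{C, n + 1} # {n + 1, R} # {R, n + 2} # {n + 1, n + 2} # es" L' C' R'])
        (use * Cons.prems(2-) Rgt in auto)
  qed
qed

section \<open>Edges of \<open>U_N(S)\<close> that lie in triangles\<close>

lemma length_grow_U: "length (grow (U_end r) S L C R n) = 4 * length S + 2 * r + 2"
  by (induction "U_end r" S L C R n rule: grow.induct) (auto simp: U_end_def V_end_def)

text \<open>Positions 0, 1 and \<open>2 * r + 1\<close> hold the edge between the old and the new
  centre and the two ends of the path. Since \<open>2 \<le> r\<close>, there is a second path vertex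
  \<open>y\<close>, which closes a triangle on the first spoke; \<open>fan_in_triangle\<close> gives
  the rest.\<close>

lemma U_end_in_triangle:
  assumes "L \<le> n" "C \<le> n" "R \<le> n" "L \<noteq> R" and "2 \<le> r" "i < 2 * r + 1" "i \<noteq> 0" "i \<noteq> 1"
  shows "in_triangle (set (U_end r L C R n)) (U_end r L C R n ! i)"
proof -
  define c x y where "c = n + 1" and "x = n + 2" and "y = n + 3"
  define xs where "xs = [n + 3..<n + r + 2]"
  have ne: "xs = y # [n + 4..<n + r + 2]"
    using assms(5) by (simp add: xs_def y_def upt_conv_Cons add.commute del: upt_Suc)
  have U: "U_end r L C R n = {C, c} # {L, x} # {x, c} # fan x c R xs"
    using assms(5) by (simp add: U_end_def V_end_def c_def x_def xs_def upt_conv_Cons numeral_3_eq_3 del: upt_Suc)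
  have d: "distinct (x # c # xs)" "R \<notin> set (c # xs)"
    using assms(1-4) by (auto simp: c_def x_def xs_def)
  consider "i = 2" | "i = 3" | j where "i = j + 3" "j \<noteq> 0" "j < 2 * length xs"
  proof -
    have "i = 2 \<or> i = 3 \<or> i = (i - 3) + 3 \<and> i - 3 \<noteq> 0 \<and> i - 3 < 2 * length xs"
      using assms(5-) by (auto simp: xs_def)
    then show ?thesis using that by blast
  qed
  then show ?thesis
  proof cases
    case 1
    have "in_triangle (set (U_end r L C R n)) {x, c}"
      by (rule in_triangleI[of _ x c y]) (use d ne in \<open>auto simp: U insert_commute\<close>)
    then show ?thesis using 1 by (simp add: U)
  next
    case 2
    have "in_triangle (set (U_end r L C R n)) {x, y}"
      by (rule in_triangleI[of _ x y c]) (use d ne in \<open>auto simp: U insert_commute\<close>)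
    then show ?thesis using 2 ne by (simp add: U)
  next
    case 3
    then show ?thesis
      using fan_in_triangle[OF d 3(3,2)] by (auto simp: U intro: in_triangle_mono)
  qed
qed

text \<open>Each side contributes four edges: the first, at position \<open>4 * j\<close>, joins
  consecutive centres, and the other three form a triangle. The remaining exclusions are those of
  \<open>U_end\<close>.\<close>

lemma grow_U_in_triangle:
  assumes "L \<le> n" "C \<le> n" "R \<le> n" "distinct [L, C, R]" and "2 \<le> r"
    and "i < 4 * length S + 2 * r + 1" "\<And>j. j \<le> length S \<Longrightarrow> i \<noteq> 4 * j" "i \<noteq> 4 * length S + 1"
  shows "in_triangle (set (grow (U_end r) S L C R n)) (grow (U_end r) S L C R n ! i)"
  using assms
proof (induction S arbitrary: L C R n i)
  case Nil
  then show ?case using U_end_in_triangle by simp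
next
  case (Cons s S)
  let ?X = "if s = Lft then L else R" and ?L = "if s = Lft then n + 2 else L" and ?R = "if s = Lft then R else n + 2"
  let ?g = "grow (U_end r) S ?L (n + 1) ?R (n + 2)"
  have g: "grow (U_end r) (s # S) L C R n = {C, n + 1} # {n + 1, ?X} # {?X, n + 2} # {n + 1, n + 2} # ?g"
    by (cases s) auto
  have X: "?X \<le> n" using Cons.prems by auto
  consider "i = 1" | "i = 2" | "i = 3" | j where "i = j + 4"
  proof -
    have "i \<noteq> 0" using Cons.prems(7)[of 0] by simp
    then have "i = 1 \<or> i = 2 \<or> i = 3 \<or> i = (i - 4) + 4" by linarith
    then show ?thesis using that by blast
  qed
  then show ?case
  proof cases
    case 1
    have "in_triangle (set (grow (U_end r) (s # S) L C R n)) {n + 1, ?X}"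
      by (rule in_triangleI[of _ "n + 1" ?X "n + 2"]) (use X in \<open>auto simp: g\<close>)
    then show ?thesis using 1 by (simp add: g)
  next
    case 2
    have "in_triangle (set (grow (U_end r) (s # S) L C R n)) {?X, n + 2}"
      by (rule in_triangleI[of _ ?X "n + 2" "n + 1"]) (use X in \<open>auto simp: g insert_commute\<close>)
    then show ?thesis using 2 by (simp add: g)
  next
    case 3
    have "in_triangle (set (grow (U_end r) (s # S) L C R n)) {n + 1, n + 2}"
      by (rule in_triangleI[of _ "n + 1" "n + 2" ?X]) (use X in \<open>auto simp: g insert_commute\<close>)
    then show ?thesis using 3 by (simp add: g)
  next
    case 4
    have "in_triangle (set ?g) (?g ! j)"
    proof (rule Cons.IH)
      show "j \<noteq> 4 * l" if "l \<le> length S" for l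
        using Cons.prems(7)[of "Suc l"] that 4 by auto
    qed (use Cons.prems 4 in auto)
    then have "in_triangle (set (grow (U_end r) (s # S) L C R n)) (?g ! j)"
      by (rule in_triangle_mono) (auto simp: g)
    then show ?thesis using 4 by (simp add: g)
  qed
qed

section \<open>The surviving contractions\<close>

lemma map_image_ident:
  assumes "\<And>e. e \<in> set es \<Longrightarrow> e \<subseteq> {0..n}" "\<And>v. v \<le> n \<Longrightarrow> h v = v"
  shows "map (image h) es = es"
proof (rule map_idI)
  fix e assume "e \<in> set es"
  then have "\<forall>v\<in>e. h v = v" using assms by fastforce
  then show "h ` e = e" by (auto simp: image_iff)
qed

text \<open>For \<open>q < p\<close> this is a quotient map whose image is again an initial interval
  of the naturals, matching the vertex names of \<open>V_graph\<close>.\<close>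

definition collapse :: "nat \<Rightarrow> nat \<Rightarrow> nat \<Rightarrow> nat" where
  "collapse p q v = (if v = p then q else if v > p then v - 1 else v)"

lemma contract_collapse:
  assumes "q < p" "p \<le> Suc M"
  shows "signed_iso 1 (contract (LGraph {0..Suc M} (xs @ {q, p} # ys)) (length xs))
    (LGraph {0..M} (map (image (collapse p q)) (xs @ ys)))"
proof (rule contract_signed_iso)
  show inj: "inj_on (collapse p q) ({0..Suc M} - {p})"
    by (auto simp: inj_on_def collapse_def split: if_splits)
  show "collapse p q ` {0..Suc M} = {0..M}"
  proof (intro equalityI subsetI)
    fix v assume "v \<in> {0..M}"
    then have "v = collapse p q (if v < p then v else v + 1)" "(if v < p then v else v + 1) \<in> {0..Suc M}"
      by (auto simp: collapse_def)
    then show "v \<in> collapse p q ` {0..Suc M}" by blast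
  qed (use assms in \<open>auto simp: collapse_def split: if_splits\<close>)
qed (use assms in \<open>auto simp: collapse_def\<close>)

lemma map_collapse_upt: "map (collapse p q) [p + 1..<k + 1] = [p..<k]"
proof -
  have "map (collapse p q) [p + 1..<k + 1] = map (collapse p q) (map Suc [p..<k])"
    by (simp only: map_Suc_upt) simp
  also have "\<dots> = [p..<k]" by (auto simp: collapse_def intro!: map_idI)
  finally show ?thesis .
qed

text \<open>Merging \<open>n + 1\<close> into \<open>C\<close> turns the spokes at the new centre
  into spokes at \<open>C\<close>, and the path vertices drop by one. The order of the edges already
  agrees.\<close>

lemma contract_centre:
  assumes "L \<le> n" "C \<le> n" "R \<le> n" "\<And>e. e \<in> set es \<Longrightarrow> e \<subseteq> {0..n}"
  shows "signed_iso 1 (contract (LGraph {0..n + r + 1} (es @ U_end r L C R n)) (length es))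
    (LGraph {0..n + r} (es @ V_end r L C R n))"
proof -
  let ?h = "collapse (n + 1) C"
  have h: "?h v = v" if "v \<le> n" for v using that by (auto simp: collapse_def)
  have "map (image ?h) (V_end r L (n + 1) R (n + 1)) = V_end r L C R n"
  proof -
    have "map ?h [n + 1 + 1..<n + 1 + r + 1] = [n + 1..<n + r + 1]"
      using map_collapse_upt[of "n + 1" C "n + 1 + r"] by (simp add: add.commute del: upt_Suc)
    moreover have "?h (n + 1) = C" by (simp add: collapse_def)
    ultimately show ?thesis by (simp only: V_end_def map_image_fan h assms)
  qed
  moreover have "map (image ?h) es = es" using assms(4) h by (rule map_image_ident)
  ultimately show ?thesis
    using contract_collapse[of C "n + 1" "n + r" es "V_end r L (n + 1) R (n + 1)"] assms(2)
    by (simp add: U_end_def)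
qed

text \<open>When the first path vertex is merged into \<open>L\<close>, its spoke becomes
  \<open>{n + 1, L}\<close>, and the next path edge and spoke become \<open>{L, n + 2}\<close> and
  \<open>{n + 1, n + 2}\<close>. With \<open>{C, n + 1}\<close> these are the four edges of a left
  step, in the right order.\<close>

lemma contract_left_end:
  assumes "L \<le> n" "C \<le> n" "R \<le> n" "\<And>e. e \<in> set es \<Longrightarrow> e \<subseteq> {0..n}"
  shows "signed_iso 1 (contract (LGraph {0..n + r + 3} (es @ U_end (r + 2) L C R n)) (length es + 1))
    (LGraph {0..n + r + 2} (es @ grow (V_end r) [Lft] L C R n))"
proof -
  let ?h = "collapse (Suc (Suc n)) L"
  let ?xs = "es @ [{C, n + 1}]" and ?ys = "{n + 2, n + 1} # {n + 2, n + 3} # {n + 3, n + 1} #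
    fan (n + 3) (n + 1) R [n + 4..<n + r + 4]"
  have h: "?h v = v" if "v \<le> n + 1" for v using that by (auto simp: collapse_def)
  have h': "?h (Suc (Suc n)) = L" "?h (Suc (Suc (Suc n))) = Suc (Suc n)" by (auto simp: collapse_def)
  have U: "es @ U_end (r + 2) L C R n = ?xs @ {L, n + 2} # ?ys"
  proof -
    have "[n + 1 + 1..<n + 1 + (r + 2) + 1] = (n + 2) # (n + 3) # [n + 4..<n + r + 4]"
      by (simp add: upt_conv_Cons numeral_eq_Suc del: upt_Suc)
    then show ?thesis by (simp only: U_end_def V_end_def fan.simps append_Cons append_Nil append_assoc)
  qed
  have upt: "map ?h [n + 4..<n + r + 4] = [Suc (Suc (Suc n))..<Suc (Suc (Suc (n + r)))]"
  proof -
    have "[n + 4..<n + r + 4] = map Suc [Suc (Suc (Suc n))..<Suc (Suc (Suc (n + r)))]"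
      by (simp only: map_Suc_upt) (simp add: numeral_eq_Suc del: upt_Suc)
    then show ?thesis by (auto simp: collapse_def o_def intro!: map_idI)
  qed
  have "map (image ?h) (?xs @ ?ys) = es @ grow (V_end r) [Lft] L C R n"
  proof -
    have "map (image ?h) es = es"
      by (rule map_image_ident[OF assms(4)]) (simp_all add: collapse_def)
    then show ?thesis
      using assms h
      by (simp add: h' map_image_fan upt V_end_def insert_commute numeral_3_eq_3 del: upt_Suc)
  qed
  then show ?thesis
    using contract_collapse[of L "n + 2" "n + r + 2" ?xs ?ys] assms(1)
    unfolding U by (simp add: numeral_eq_Suc del: upt_Suc)
qed

text \<open>Here the last three edges of the right step come out at the end of the list, in reverse
  order. Moving them past the \<open>2 * r + 1\<close> edges of the fan is odd, and so is reversing
  them; the signs cancel.\<close>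

lemma contract_right_end:
  assumes "L \<le> n" "C \<le> n" "R \<le> n" "\<And>e. e \<in> set es \<Longrightarrow> e \<subseteq> {0..n}"
  shows "signed_iso 1 (contract (LGraph {0..n + r + 3} (es @ U_end (r + 2) L C R n)) (length es + 2 * r + 5))
    (LGraph {0..n + r + 2} (es @ grow (V_end r) [Rgt] L C R n))"
proof -
  define c z w where "c = n + 1" and "z = n + r + 2" and "w = n + r + 3"
  \<comment> \<open>The last path vertex \<open>w\<close> merges into \<open>R\<close>, its
    predecessor \<open>z\<close> gets the name \<open>n + 2\<close> of the new right vertex, and the
    other path vertices move up by one to make room.\<close>
  define h where "h = (\<lambda>v. if v = w then R else if v = z then n + 2 else if n + 2 \<le> v then v + 1 else v)"
  let ?F = "fan L c (n + 2) [n + 3..<n + r + 3]"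
  let ?xs = "es @ {C, c} # fan L c z [n + 2..<n + r + 2] @ [{z, c}, {z, w}, {w, c}]"
  have h_old: "h v = v" if "v \<le> n + 1" for v using that by (auto simp: h_def w_def z_def)
  have h_new: "h c = c" "h z = n + 2" "h w = R" by (auto simp: h_def c_def w_def z_def)
  have U: "es @ U_end (r + 2) L C R n = ?xs @ {R, w} # []"
  proof -
    have "[n + 1 + 1..<n + 1 + (r + 2) + 1] = ([n + 2..<n + r + 2] @ [z]) @ [w]"
      by (simp add: z_def w_def numeral_eq_Suc)
    then show ?thesis
      by (simp only: U_end_def V_end_def fan_snoc) (simp add: c_def insert_commute del: upt_Suc)
  qed
  have "signed_iso 1 (contract (LGraph {0..w} (?xs @ {R, w} # [])) (length ?xs))
      (LGraph {0..z} (map (image h) (?xs @ [])))"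
  proof (rule contract_signed_iso)
    show inj: "inj_on h ({0..w} - {w})"
      by (auto simp: inj_on_def h_def w_def z_def split: if_splits)
    have "h ` {0..w} = h ` ({0..w} - {w})"
    proof -
      have "h w \<in> h ` ({0..w} - {w})"
        using assms(3) by (intro rev_image_eqI[of R]) (auto simp: h_def w_def z_def)
      then show ?thesis by (auto simp: image_iff)
    qed
    also have "\<dots> = {0..z}"
    proof (rule card_subset_eq)
      show "card (h ` ({0..w} - {w})) = card {0..z}"
        unfolding card_image[OF inj] by (simp add: w_def z_def)
    qed (auto simp: h_def w_def z_def split: if_splits)
    finally show "h ` {0..w} = {0..z}" .
  qed (use assms in \<open>auto simp: h_def w_def z_def\<close>)
  moreover have "map (image h) (?xs @ []) = (es @ [{C, c}]) @ ?F @ [{n + 2, c}, {n + 2, R}, {R, c}] @ []"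
  proof -
    have "map h [n + 2..<n + r + 2] = map Suc [n + 2..<n + r + 2]"
      by (rule map_cong) (auto simp: h_def w_def z_def)
    then have "map h [n + 2..<n + r + 2] = [n + 3..<n + r + 3]"
      by (simp only: map_Suc_upt) (simp add: numeral_eq_Suc del: upt_Suc)
    moreover have "map (image h) es = es"
      by (rule map_image_ident[OF assms(4)]) (auto intro: h_old)
    ultimately show ?thesis
      using assms(1,2) by (simp add: map_image_fan h_old h_new del: upt_Suc)
  qed
  ultimately have 1: "signed_iso 1 (contract (LGraph {0..w} (?xs @ {R, w} # [])) (length ?xs))
      (LGraph {0..z} ((es @ [{C, c}]) @ ?F @ [{n + 2, c}, {n + 2, R}, {R, c}] @ []))" by simp
  have 2: "signed_iso (-1)
      (LGraph {0..z} ((es @ [{C, c}]) @ ?F @ [{n + 2, c}, {n + 2, R}, {R, c}] @ []))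
      (LGraph {0..z} ((es @ [{C, c}]) @ [{n + 2, c}, {n + 2, R}, {R, c}] @ ?F @ []))"
    using signed_iso_swap_blocks[of ?F "[{n + 2, c}, {n + 2, R}, {R, c}]" "{0..z}" "es @ [{C, c}]" "[]"]
    by (simp add: power_add power_mult del: upt_Suc)
  have 3: "signed_iso (-1)
      (LGraph {0..z} ((es @ [{C, c}]) @ [{n + 2, c}, {n + 2, R}, {R, c}] @ ?F @ []))
      (LGraph {0..z} ((es @ [{C, c}]) @ [{R, c}, {n + 2, R}, {n + 2, c}] @ ?F @ []))"
    using signed_iso_rev[of "[{n + 2, c}, {n + 2, R}, {R, c}]" "{0..z}" "es @ [{C, c}]" "?F @ []"]
    by (simp del: upt_Suc)
  have "(es @ [{C, c}]) @ [{R, c}, {n + 2, R}, {n + 2, c}] @ ?F @ [] = es @ grow (V_end r) [Rgt] L C R n"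
    by (simp add: V_end_def c_def insert_commute numeral_3_eq_3 del: upt_Suc)
  then have "signed_iso 1 (contract (LGraph {0..w} (?xs @ {R, w} # [])) (length ?xs))
      (LGraph {0..z} (es @ grow (V_end r) [Rgt] L C R n))"
    using signed_iso_trans[OF signed_iso_trans[OF 1 2] 3] by (simp only:) simp
  moreover have "length ?xs = length es + 2 * r + 5" by (simp del: upt_Suc)
  ultimately show ?thesis unfolding U[symmetric] by (simp only: w_def z_def)
qed

text \<open>Position 4 after \<open>es\<close> is the edge joining the two new centres. After its
  contraction one centre carries a triangle at \<open>L\<close> and one at \<open>R\<close>,
  whichever side came first. The outcomes differ in the names \<open>n + 2\<close> and
  \<open>n + 4\<close> and in the order of two blocks of three labels, which costs nine
  transpositions.\<close>

lemma contract_swap_sides: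
  assumes "L \<le> n" "C \<le> n" "R \<le> n" "\<And>e. e \<in> set es \<Longrightarrow> e \<subseteq> {0..n}" "n + 4 \<le> M"
    and F: "\<And>h L C R k. (\<And>v. v > k \<Longrightarrow> h v = v) \<Longrightarrow> map (image h) (F L C R k) = F (h L) (h C) (h R) k"
  shows "signed_iso (-1)
    (contract (LGraph {0..M} (es @ grow F (Rgt # Lft # S) L C R n)) (length es + 4))
    (contract (LGraph {0..M} (es @ grow F (Lft # Rgt # S) L C R n)) (length es + 4))"
proof -
  define a where "a = n + 1"
  \<comment> \<open>\<open>h\<close> is the contraction itself; \<open>g\<close> also exchanges
    \<open>n + 2\<close> and \<open>n + 4\<close>, the outer vertices, which the other graph creates
    in the opposite order.\<close>
  define h where "h = (\<lambda>v. if v = n + 3 then a else v)"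
  define g where "g = (\<lambda>v. if v = n + 3 then a else if v = n + 2 then n + 4 else if v = n + 4 then n + 2 else v)"
  let ?V = "{0..M} - {n + 3}"
  let ?A = "[{a, L}, {L, n + 2}, {a, n + 2}]" and ?B = "[{a, R}, {R, n + 4}, {a, n + 4}]"
  let ?rest = "grow F S (n + 2) a (n + 4) (n + 4)"
  have merge: "merge {n + 1, n + 3} = h"
    by (auto simp: merge_def h_def a_def fun_eq_iff)
  have old: "h v = v" "g v = v" if "v \<le> n" for v using that by (auto simp: h_def g_def)
  have old_es: "map (image h) es = es" "map (image g) es = es"
    using map_image_ident[OF assms(4)] old by blast+
  have new: "h (n + 1) = a" "h (n + 2) = n + 2" "h (n + 3) = a" "h (n + 4) = n + 4"
    "g (n + 1) = a" "g (n + 2) = n + 4" "g (n + 3) = a" "g (n + 4) = n + 2"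
    by (auto simp: h_def g_def a_def)
  have rest: "map (image h) (grow F S (n + 2) (n + 3) (n + 4) (n + 4)) = ?rest"
    "map (image g) (grow F S (n + 4) (n + 3) (n + 2) (n + 4)) = ?rest"
  proof -
    have fixed: "h v = v" "g v = v" if "v > n + 4" for v using that by (auto simp: h_def g_def)
    have "map (image h) (F L C R k) = F (h L) (h C) (h R) k"
      "map (image g) (F L C R k) = F (g L) (g C) (g R) k" if "n + 4 \<le> k" for L C R k
      using F[of k h] F[of k g] fixed that by auto
    then show "map (image h) (grow F S (n + 2) (n + 3) (n + 4) (n + 4)) = ?rest"
      "map (image g) (grow F S (n + 4) (n + 3) (n + 2) (n + 4)) = ?rest"
      using map_image_grow[of "n + 4" h F S "n + 2" "n + 3" "n + 4"]
        map_image_grow[of "n + 4" g F S "n + 4" "n + 3" "n + 2"] fixed unfolding new by blast+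
  qed
  have LR: "contract (LGraph {0..M} (es @ grow F (Lft # Rgt # S) L C R n)) (length es + 4) =
      LGraph ?V ((es @ [{C, a}]) @ ?A @ ?B @ ?rest)"
  proof -
    let ?xs = "es @ [{C, n + 1}, {n + 1, L}, {L, n + 2}, {n + 1, n + 2}]"
    let ?ys = "[{n + 3, R}, {R, n + 4}, {n + 3, n + 4}] @ grow F S (n + 2) (n + 3) (n + 4) (n + 4)"
    have e: "es @ grow F (Lft # Rgt # S) L C R n = ?xs @ {n + 1, n + 3} # ?ys"
      by (simp add: numeral_eq_Suc)
    have l: "length es + 4 = length ?xs" by simp
    have m: "map (image h) (?xs @ ?ys) = (es @ [{C, a}]) @ ?A @ ?B @ ?rest"
      using assms(1-3) by (simp only: map_append list.map image_insert image_empty old old_es new rest)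
        (simp only: append_assoc append_Cons append_Nil)
    have "contract (LGraph {0..M} (?xs @ {n + 1, n + 3} # ?ys)) (length ?xs) =
        LGraph ({0..M} - {Max {n + 1, n + 3}}) (map (image (merge {n + 1, n + 3})) (?xs @ ?ys))"
      by (simp only: contract_def lgraph.sel nth_append_length) simp
    then show ?thesis unfolding e l merge m by simp
  qed
  have 1: "signed_iso 1 (contract (LGraph {0..M} (es @ grow F (Rgt # Lft # S) L C R n)) (length es + 4))
      (LGraph ?V ((es @ [{C, a}]) @ ?B @ ?A @ ?rest))"
  proof -
    let ?xs = "es @ [{C, n + 1}, {n + 1, R}, {R, n + 2}, {n + 1, n + 2}]"
    let ?ys = "[{n + 3, L}, {L, n + 4}, {n + 3, n + 4}] @ grow F S (n + 4) (n + 3) (n + 2) (n + 4)"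
    have e: "es @ grow F (Rgt # Lft # S) L C R n = ?xs @ {n + 1, n + 3} # ?ys"
      by (simp add: numeral_eq_Suc)
    have l: "length es + 4 = length ?xs" by simp
    have m: "map (image g) (?xs @ ?ys) = (es @ [{C, a}]) @ ?B @ ?A @ ?rest"
      using assms(1-3) by (simp only: map_append list.map image_insert image_empty old old_es new rest)
        (simp only: append_assoc append_Cons append_Nil)
    show ?thesis
      unfolding e l m[symmetric]
    proof (rule contract_signed_iso)
      show inj: "inj_on g ({0..M} - {n + 3})"
        by (auto simp: inj_on_def g_def a_def split: if_splits)
      have "g ` {0..M} = g ` ({0..M} - {n + 3})"
      proof -
        have "g (n + 3) \<in> g ` ({0..M} - {n + 3})"
          using assms(5) by (intro rev_image_eqI[of "n + 1"]) (auto simp: g_def a_def)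
        then show ?thesis by (auto simp: image_iff)
      qed
      also have "\<dots> = {0..M} - {n + 3}"
      proof (rule card_subset_eq)
        show "card (g ` ({0..M} - {n + 3})) = card ({0..M} - {n + 3})" by (rule card_image[OF inj])
      qed (use assms(5) in \<open>auto simp: g_def a_def split: if_splits\<close>)
      finally show "g ` {0..M} = {0..M} - {n + 3}" .
    qed (use assms(5) in \<open>auto simp: g_def a_def\<close>)
  qed
  have 2: "signed_iso (-1) (LGraph ?V ((es @ [{C, a}]) @ ?B @ ?A @ ?rest))
      (LGraph ?V ((es @ [{C, a}]) @ ?A @ ?B @ ?rest))"
    using signed_iso_swap_blocks[of ?B ?A ?V "es @ [{C, a}]" ?rest] by simp
  show ?thesis unfolding LR using signed_iso_trans[OF 1 2] by (simp only: mult_1)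
qed

section \<open>Mirror images\<close>

text \<open>Traversing the path from its other end reverses a list of \<open>2 * r + 1\<close>
  edges, with sign \<open>(-1) ^ ((2 * r + 1) * r)\<close>, which is +1 for even \<open>r\<close>.
  The path vertices are then renamed by reflecting their interval.\<close>

lemma V_end_mirror:
  assumes "L \<le> n" "C \<le> n" "R \<le> n" "\<And>e. e \<in> set es \<Longrightarrow> e \<subseteq> {0..n}" "even r"
  shows "signed_iso 1 (LGraph {0..n + r} (es @ V_end r R C L n)) (LGraph {0..n + r} (es @ V_end r L C R n))"
proof -
  let ?xs = "[n + 1..<n + r + 1]"
  define h where "h = (\<lambda>v. if v \<le> n then v else 2 * n + r + 1 - v)"
  have old: "h v = v" if "v \<le> n" for v using that by (simp add: h_def)
  have h: "map h (rev ?xs) = ?xs"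
  proof (rule nth_equalityI)
    fix i assume "i < length (map h (rev ?xs))"
    then have i: "i < r" by (simp del: upt_Suc)
    then have "rev ?xs ! i = n + r - i" "?xs ! i = n + 1 + i"
      by (simp_all add: rev_nth del: upt_Suc)
    moreover have "map h (rev ?xs) ! i = h (rev ?xs ! i)"
      by (rule nth_map) (use i in \<open>simp del: upt_Suc\<close>)
    moreover have "h (n + r - i) = n + 1 + i" using i by (auto simp: h_def)
    ultimately show "map h (rev ?xs) ! i = ?xs ! i" by (simp only:)
  qed simp
  have "even ((2 * r + 1) * (2 * r + 1 - 1) div 2)"
  proof -
    have "(2 * r + 1) * (2 * r + 1 - 1) div 2 = (2 * r + 1) * r" by simp
    then show ?thesis using assms(5) by simp
  qed
  then have 1: "signed_iso 1 (LGraph {0..n + r} (es @ V_end r R C L n))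
      (LGraph {0..n + r} (es @ fan L C R (rev ?xs)))"
    using signed_iso_rev[of "V_end r R C L n" "{0..n + r}" es "[]"]
    by (simp add: V_end_def rev_fan del: upt_Suc)
  have inj: "inj_on h {0..n + r}" by (auto simp: inj_on_def h_def split: if_splits)
  moreover have "h ` {0..n + r} = {0..n + r}"
  proof (rule card_subset_eq)
    show "card (h ` {0..n + r}) = card {0..n + r}" by (rule card_image[OF inj])
  qed (auto simp: h_def)
  moreover have "map (image h) (es @ fan L C R (rev ?xs)) = es @ V_end r L C R n"
    using assms(1-3) map_image_ident[OF assms(4) old]
    by (simp only: map_append map_image_fan h old V_end_def)
  ultimately have 2: "signed_iso 1 (LGraph {0..n + r} (es @ fan L C R (rev ?xs)))
      (LGraph {0..n + r} (es @ V_end r L C R n))"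
    using signed_iso_relabel[of h "{0..n + r}"] by metis
  show ?thesis using signed_iso_trans[OF 1 2] by (simp only: mult_1)
qed

lemma U_end_mirror:
  assumes "L \<le> n" "C \<le> n" "R \<le> n" "\<And>e. e \<in> set es \<Longrightarrow> e \<subseteq> {0..n}" "even r"
  shows "signed_iso 1 (LGraph {0..n + (r + 1)} (es @ U_end r R C L n))
    (LGraph {0..n + (r + 1)} (es @ U_end r L C R n))"
proof -
  have "e \<subseteq> {0..n + 1}" if "e \<in> set (es @ [{C, n + 1}])" for e
    using that assms(2) assms(4)[of e] by fastforce
  then have "signed_iso 1 (LGraph {0..n + 1 + r} ((es @ [{C, n + 1}]) @ V_end r R (n + 1) L (n + 1)))
      (LGraph {0..n + 1 + r} ((es @ [{C, n + 1}]) @ V_end r L (n + 1) R (n + 1)))"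
    using assms(1,3,5) by (intro V_end_mirror) auto
  then show ?thesis by (simp add: U_end_def)
qed

text \<open>Exchanging the vertices 1 and 3 reverses the first three start edges and swaps the last
  two; both are odd, so the start contributes +1. The steps for \<open>S\<close> become those for
  \<open>map flip S\<close>, except that \<open>L\<close> and \<open>R\<close> arrive exchanged at
  the end, which \<open>mirror\<close> repairs.\<close>

lemma grow_mirror:
  assumes F: "\<And>h L C R k. (\<And>v. v > k \<Longrightarrow> h v = v) \<Longrightarrow> map (image h) (F L C R k) = F (h L) (h C) (h R) k"
    and mirror: "\<And>L C R n es. L \<le> n \<Longrightarrow> C \<le> n \<Longrightarrow> R \<le> n \<Longrightarrow> (\<And>e. e \<in> set es \<Longrightarrow> e \<subseteq> {0..n}) \<Longrightarrow>
      signed_iso 1 (LGraph {0..n + p} (es @ F R C L n)) (LGraph {0..n + p} (es @ F L C R n))"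
    and N: "N = 3 + 2 * length S + p"
  shows "signed_iso 1 (LGraph {0..N} (start_edges @ grow F S 1 2 3 3))
    (LGraph {0..N} (start_edges @ grow F (map flip S) 1 2 3 3))"
proof -
  let ?h = "transpose 1 3 :: nat \<Rightarrow> nat"
  have h: "?h 0 = 0" "?h 1 = 3" "?h (Suc 0) = 3" "?h 2 = 2" "?h 3 = 1" by (auto simp: transpose_def)
  obtain es L C R where g: "\<And>F. grow F (map flip S) 1 2 3 3 = es @ F L C R (3 + 2 * length (map flip S))"
    and le: "L \<le> 3 + 2 * length (map flip S)" "C \<le> 3 + 2 * length (map flip S)" "R \<le> 3 + 2 * length (map flip S)"
    and es: "\<And>e. e \<in> set es \<Longrightarrow> e \<subseteq> {0..3 + 2 * length (map flip S)}"
    by (rule grow_decompose[of 1 3 2 3 "map flip S"]) auto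
  have fixed: "?h v = v" if "v > 3" for v using that by (auto simp: transpose_def)
  have "map (image ?h) (F L C R k) = F (?h L) (?h C) (?h R) k" if "3 \<le> k" for L C R k
    by (rule F, rule fixed) (use that in simp)
  then have "map (image ?h) (grow F S 1 2 3 3) = grow F S 3 2 1 3"
    using map_image_grow[of 3 ?h F S 1 2 3] fixed unfolding h by blast
  also have "\<dots> = es @ F R C L (3 + 2 * length S)"
    by (subst grow_flip) (simp only: g length_map)
  finally have 1: "signed_iso 1 (LGraph {0..N} (start_edges @ grow F S 1 2 3 3))
      (LGraph {0..N} ([] @ [{0, 3}, {0, 2}, {0, 1}] @ {2, 3} # {1, 2} # es @ F R C L (3 + 2 * length S)))"
    using signed_iso_relabel[of ?h "{0..N}" "start_edges @ grow F S 1 2 3 3"] N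
    by (simp add: start_edges_def h insert_commute inj_on_transpose)
  have 2: "signed_iso (-1)
      (LGraph {0..N} ([] @ [{0, 3}, {0, 2}, {0, 1}] @ {2, 3} # {1, 2} # es @ F R C L (3 + 2 * length S)))
      (LGraph {0..N} ([{0, 1}, {0, 2}, {0, 3}] @ {2, 3} # {1, 2} # es @ F R C L (3 + 2 * length S)))"
    using signed_iso_rev[of "[{0, 3}, {0, 2}, {0, 1}]" "{0..N}" "[]"] by simp
  have 3: "signed_iso (-1)
      (LGraph {0..N} ([{0, 1}, {0, 2}, {0, 3}] @ {2, 3} # {1, 2} # es @ F R C L (3 + 2 * length S)))
      (LGraph {0..N} ([{0, 1}, {0, 2}, {0, 3}] @ {1, 2} # {2, 3} # es @ F R C L (3 + 2 * length S)))"
    by (rule signed_iso_swap)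
  have "e \<subseteq> {0..3 + 2 * length S}" if "e \<in> set (start_edges @ es)" for e
    using that es[of e] by (auto simp: start_edges_def)
  then have 4: "signed_iso 1 (LGraph {0..N} ((start_edges @ es) @ F R C L (3 + 2 * length S)))
      (LGraph {0..N} ((start_edges @ es) @ F L C R (3 + 2 * length S)))"
    unfolding N using le by (intro mirror) auto
  have "signed_iso 1 (LGraph {0..N} (start_edges @ grow F S 1 2 3 3))
      (LGraph {0..N} ((start_edges @ es) @ F R C L (3 + 2 * length S)))"
    using signed_iso_trans[OF signed_iso_trans[OF 1 2] 3] by (simp add: start_edges_def)
  from signed_iso_trans[OF this 4] show ?thesis
    by (simp add: g[unfolded One_nat_def])
qed

section \<open>The boundary of \<open>U\<^sub>N(S)\<close>\<close>

lemma num_edges_U: "num_edges (LGraph V (start_edges @ grow (U_end r) S L C R n)) = 4 * length S + 2 * r + 7"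
  by (simp add: length_grow_U start_edges_def)

lemma start_edges_in_triangle:
  assumes "e \<in> set start_edges"
  shows "in_triangle (set start_edges) e"
proof -
  have "in_triangle (set start_edges) {0, 1}" by (rule in_triangleI[of _ 0 1 2]) (auto simp: start_edges_def)
  moreover have "in_triangle (set start_edges) {0, 2}" by (rule in_triangleI[of _ 0 2 1]) (auto simp: start_edges_def insert_commute)
  moreover have "in_triangle (set start_edges) {0, 3}" by (rule in_triangleI[of _ 0 3 2]) (auto simp: start_edges_def insert_commute)
  moreover have "in_triangle (set start_edges) {1, 2}" by (rule in_triangleI[of _ 1 2 0]) (auto simp: start_edges_def insert_commute)
  moreover have "in_triangle (set start_edges) {2, 3}" by (rule in_triangleI[of _ 2 3 0]) (auto simp: start_edges_def insert_commute)
  ultimately show ?thesis using assms by (auto simp: start_edges_def)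
qed

text \<open>Labels are positions in \<open>grow\<close> shifted by the five start edges. Excluded
  are the edges between consecutive centres after the first step, the edge of step 3 and the two
  ends of the closing path.\<close>

lemma contracted_class_U_zero:
  assumes "2 \<le> r" and i: "i < 4 * length S + 2 * r + 6"
    and spec: "\<And>j. 1 \<le> j \<Longrightarrow> j \<le> length S \<Longrightarrow> i \<noteq> 4 * j + 5" "S = [] \<Longrightarrow> i \<noteq> 5" "i \<noteq> 4 * length S + 6"
  shows "contracted_class (LGraph V (start_edges @ grow (U_end r) S 1 2 3 3)) i = 0"
proof (rule contracted_class_triangle)
  let ?g = "grow (U_end r) S 1 2 3 3"
  have l: "length start_edges = 5" by (simp add: start_edges_def)
  show "i < num_edges (LGraph V (start_edges @ ?g))" using i unfolding num_edges_U by simp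
  consider "i < 5" | "i = 5" | "5 < i" by linarith
  then have "in_triangle (set (start_edges @ ?g)) ((start_edges @ ?g) ! i)"
  proof cases
    case 1
    then have "in_triangle (set start_edges) (start_edges ! i)"
      using l by (intro start_edges_in_triangle) simp
    then show ?thesis using 1 l by (auto simp: nth_append intro: in_triangle_mono)
  next
    case 2
    with spec(2) obtain s T where S: "S = s # T" by (cases S) auto
    let ?X = "if s = Lft then 1 else 3"
    have "\<exists>es. ?g = {2, 4} # {4, ?X} # es" by (cases s) (simp_all add: S)
    then obtain es where g: "?g = {2, 4} # {4, ?X} # es" by blast
    \<comment> \<open>Label 5 joins the centres 2 and 4. Its triangle uses a start edge from 2 to
      \<open>?X\<close>, so it is not visible in \<open>grow\<close> alone.\<close>
    have "in_triangle (set (start_edges @ ?g)) {2, 4}"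
      unfolding g by (rule in_triangleI[of _ 2 4 ?X]) (auto simp: start_edges_def insert_commute)
    then show ?thesis using 2 l g by (simp add: nth_append)
  next
    case 3
    define j where "j = i - 5"
    have j: "i = j + 5" "j \<noteq> 0" using 3 by (auto simp: j_def)
    have "in_triangle (set ?g) (?g ! j)"
    proof (rule grow_U_in_triangle)
      show "j \<noteq> 4 * l" if "l \<le> length S" for l
        using spec(1)[of l] that j by (cases "l = 0") auto
    qed (use assms j in auto)
    then show ?thesis using j l by (auto simp: nth_append intro: in_triangle_mono)
  qed
  then show "in_triangle (set (edges (LGraph V (start_edges @ ?g)))) (edges (LGraph V (start_edges @ ?g)) ! i)"
    by simp
qed

text \<open>List positions start at 0, so for \<open>1 \<le> j\<close> and
  \<open>j < length xs\<close> the entries \<open>j\<close> and \<open>j + 1\<close>, counted from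
  1, are exchanged.\<close>

definition swap_at :: "nat \<Rightarrow> 'a list \<Rightarrow> 'a list" where
  "swap_at j xs = xs[j - 1 := xs ! j, j := xs ! (j - 1)]"

lemma swap_at_append: "swap_at (Suc (length xs)) (xs @ x # y # ys) = xs @ y # x # ys"
  by (simp add: swap_at_def nth_append list_update_append)

text \<open>Label \<open>4 * j + 5\<close> joins the centres created in steps \<open>j\<close> and
  \<open>j + 1\<close>. If the two sides differ, \<open>contract_swap_sides\<close> applies. If they
  agree, the exchange changes nothing, and the edge lies in a triangle with the outer vertex of step
  \<open>j\<close>, so both terms vanish.\<close>

lemma contracted_class_U_swap:
  assumes "odd N" "2 * length S + 3 < N" "1 \<le> j" "j < length S"
  shows "contracted_class (U_graph N (swap_at j S)) (4 * j + 5) =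
    - (contracted_class (U_graph N S) (4 * j + 5) :: 'k::field_char_0 gc)"
proof -
  define A B where "A = take (j - 1) S" and "B = drop (j + 1) S"
  define r where "r = N - 2 * length S - 3"
  have lA: "length A = j - 1" using assms by (simp add: A_def)
  have S: "S = A @ S ! (j - 1) # S ! j # B"
    using assms(3,4) id_take_nth_drop[of "j - 1" S] Cons_nth_drop_Suc[of j S]
    by (simp add: A_def B_def)
  define x y where "x = S ! (j - 1)" and "y = S ! j"
  have S: "S = A @ x # y # B" using S by (simp add: x_def y_def)
  have swap: "swap_at j S = A @ y # x # B"
    using swap_at_append[of A x y B] lA assms(3) unfolding S by simp
  obtain es L C R where
    dec: "\<And>F. grow F A 1 2 3 3 = es @ F L C R (3 + 2 * length A)"
    and le: "L \<le> 3 + 2 * length A" "C \<le> 3 + 2 * length A" "R \<le> 3 + 2 * length A" and d: "distinct [L, C, R]"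
    and les: "length es = 4 * length A" and es: "\<And>e. e \<in> set es \<Longrightarrow> e \<subseteq> {0..3 + 2 * length A}"
    by (rule grow_decompose[of 1 3 2 3 A]) auto
  let ?n = "3 + 2 * length A"
  have U: "U_graph N (A @ T) = LGraph {0..N + 1} ((start_edges @ es) @ grow (U_end r) T L C R ?n)"
    if "length T = length B + 2" for T
  proof -
    have "length (A @ T) = length S" using that by (simp add: S)
    then show ?thesis using assms(2) by (simp add: U_graph_grow r_def grow_append dec[unfolded One_nat_def])
  qed
  have idx: "4 * j + 5 = length (start_edges @ es) + 4"
    using assms(3) by (simp add: start_edges_def les lA)
  have sub: "e \<subseteq> {0..?n}" if "e \<in> set (start_edges @ es)" for e
    using that es[of e] by (auto simp: start_edges_def)
  have adm: "admissible (U_graph N (A @ T))" and num: "num_edges (U_graph N (A @ T)) = 2 * N + 1"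
    if "length T = length B + 2" for T
    using that U_graph_admissible[OF assms(1), of "A @ T"] U_graph_size[of "A @ T" N] assms(2)
    by (simp_all add: S)
  have lt: "4 * j + 5 < 2 * N + 1" using assms by linarith
  have main: "contracted_class (U_graph N (A @ Rgt # Lft # B)) (4 * j + 5) =
    - (contracted_class (U_graph N (A @ Lft # Rgt # B)) (4 * j + 5) :: 'k gc)"
  proof -
    have "signed_iso (-1) (contract (U_graph N (A @ Rgt # Lft # B)) (4 * j + 5))
      (contract (U_graph N (A @ Lft # Rgt # B)) (4 * j + 5))"
    proof -
      have M: "?n + 4 \<le> N + 1" using assms(2) by (simp add: S)
      have "U_graph N (A @ s # t # B) = LGraph {0..N + 1} ((start_edges @ es) @ grow (U_end r) (s # t # B) L C R ?n)"
        for s t by (rule U) simp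
      then show ?thesis
        unfolding idx by (simp only:) (rule contract_swap_sides[OF le sub M], simp_all add: map_image_U_end)
    qed
    from contracted_class_signed_iso_contract[OF this adm _ adm]
    show ?thesis using lt by (simp add: num)
  qed
  have same: "contracted_class (U_graph N (A @ s # s # B)) (4 * j + 5) = (0 :: 'k gc)" for s
  proof (rule contracted_class_triangle)
    let ?X = "if s = Lft then L else R"
    have "\<exists>T. grow (U_end r) (s # s # B) L C R ?n = {C, ?n + 1} # {?n + 1, ?X} # {?X, ?n + 2} # {?n + 1, ?n + 2} #
        {?n + 1, ?n + 3} # {?n + 3, ?n + 2} # T"
      by (cases s) (simp_all add: numeral_eq_Suc)
    then obtain T where T: "grow (U_end r) (s # s # B) L C R ?n = {C, ?n + 1} # {?n + 1, ?X} # {?X, ?n + 2} #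
        {?n + 1, ?n + 2} # {?n + 1, ?n + 3} # {?n + 3, ?n + 2} # T" ..
    have E: "edges (U_graph N (A @ s # s # B)) = (start_edges @ es) @ {C, ?n + 1} # {?n + 1, ?X} # {?X, ?n + 2} #
        {?n + 1, ?n + 2} # {?n + 1, ?n + 3} # {?n + 3, ?n + 2} # T"
      by (subst U) (simp_all only: T lgraph.sel, simp)
    have i: "edges (U_graph N (A @ s # s # B)) ! (4 * j + 5) = {?n + 1, ?n + 3}"
      unfolding idx E nth_append_length_plus by simp
    show "in_triangle (set (edges (U_graph N (A @ s # s # B)))) (edges (U_graph N (A @ s # s # B)) ! (4 * j + 5))"
      unfolding i by (rule in_triangleI[of _ "?n + 1" "?n + 3" "?n + 2"]) (auto simp: E)
    show "4 * j + 5 < num_edges (U_graph N (A @ s # s # B))" using lt num by simp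
  qed
  show ?thesis
    unfolding swap using main same by (cases x; cases y) (simp_all add: S)
qed

text \<open>With \<open>2 * N + 1\<close> edges the sign at label \<open>i\<close> is
  \<open>(-1) ^ i\<close>. For \<open>k = length S\<close>, the labels \<open>4 * j + 5\<close> and
  \<open>4 * k + 5\<close> are odd, while \<open>4 * k + 6\<close> and \<open>2 * N\<close>, the
  ends of the path, are even.\<close>

lemma gc_boundary_U:
  assumes "odd N" "2 * length S + 3 < N"
  shows "gc_boundary (U_elt N S :: 'k::field_char_0 gc) =
    V_elt N (S @ [Lft]) + V_elt N (S @ [Rgt]) - V_elt N S
    - (\<Sum>j\<in>{1..<length S}. contracted_class (U_graph N S) (4 * j + 5))"
proof -
  let ?k = "length S" and ?G = "U_graph N S"
  \<comment> \<open>The closing path has \<open>q + 2\<close> inner vertices. Oddness of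
    \<open>N\<close> rules out \<open>N = 2 * length S + 4\<close>, so the subtraction is not
    truncated.\<close>
  define q where "q = N - 2 * length S - 5"
  have N: "N = 2 * ?k + q + 5"
  proof -
    have "N \<noteq> 2 * ?k + 4" using assms(1) by auto
    then show ?thesis using assms(2) by (simp add: q_def)
  qed
  let ?c = "contracted_class ?G :: nat \<Rightarrow> 'k gc"
  obtain es L C R where
    dec: "\<And>F. grow F S 1 2 3 3 = es @ F L C R (3 + 2 * ?k)"
    and le: "L \<le> 3 + 2 * ?k" "C \<le> 3 + 2 * ?k" "R \<le> 3 + 2 * ?k"
    and les: "length es = 4 * ?k" and es: "\<And>e. e \<in> set es \<Longrightarrow> e \<subseteq> {0..3 + 2 * ?k}"
    by (rule grow_decompose[of 1 3 2 3 S]) auto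
  let ?n = "3 + 2 * ?k" and ?es = "start_edges @ es"
  have sub: "e \<subseteq> {0..?n}" if "e \<in> set ?es" for e
    using that es[of e] by (auto simp: start_edges_def)
  have len: "length ?es = 4 * ?k + 5" by (simp add: start_edges_def les)
  have U': "?G = LGraph {0..N + 1} (start_edges @ grow (U_end (q + 2)) S 1 2 3 3)"
    using U_graph_grow[OF assms(2)] N by simp
  then have U: "?G = LGraph {0..N + 1} (?es @ U_end (q + 2) L C R ?n)" by (simp add: dec[unfolded One_nat_def])
  have adm: "admissible ?G" using U_graph_admissible assms by blast
  have num: "num_edges ?G = 2 * N + 1" using U_graph_size assms by blast
  have centre: "?c (4 * ?k + 5) = V_elt N S"
  proof -
    have "V_graph N S = LGraph {0..N} (?es @ V_end (q + 2) L C R ?n)"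
      using N by (subst V_graph_grow) (simp_all add: dec[unfolded One_nat_def])
    moreover have "signed_iso 1 (contract (LGraph {0..?n + (q + 2) + 1} (?es @ U_end (q + 2) L C R ?n)) (length ?es))
        (LGraph {0..?n + (q + 2)} (?es @ V_end (q + 2) L C R ?n))"
      by (rule contract_centre[OF le sub])
    moreover have "N + 1 = ?n + (q + 2) + 1" "N = ?n + (q + 2)" using N by auto
    ultimately have "signed_iso 1 (contract ?G (4 * ?k + 5)) (V_graph N S)"
      unfolding U len by (simp only:)
    from contracted_class_signed_iso[OF this adm _ V_graph_admissible] show ?thesis
      using num N by (simp add: V_elt_def)
  qed
  have V: "V_graph N (S @ [s]) = LGraph {0..N} (?es @ grow (V_end q) [s] L C R ?n)" for s
    using N by (subst V_graph_grow) (simp_all add: grow_append dec[unfolded One_nat_def])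
  have Ns: "N + 1 = ?n + q + 3" "N = ?n + q + 2" using N by auto
  have left: "?c (4 * ?k + 6) = V_elt N (S @ [Lft])"
  proof -
    have "4 * ?k + 6 = length ?es + 1" unfolding len by simp
    then have "signed_iso 1 (contract ?G (4 * ?k + 6)) (V_graph N (S @ [Lft]))"
      unfolding U V Ns(1) by (simp only:) (simp only: Ns(2), rule contract_left_end[OF le sub])
    from contracted_class_signed_iso[OF this adm _ V_graph_admissible] show ?thesis
      using num N by (simp add: V_elt_def)
  qed
  have right: "?c (2 * N) = V_elt N (S @ [Rgt])"
  proof -
    have "2 * N = length ?es + 2 * q + 5" using N unfolding len by simp
    then have "signed_iso 1 (contract ?G (2 * N)) (V_graph N (S @ [Rgt]))"
      unfolding U V Ns(1) by (simp only:) (simp only: Ns(2), rule contract_right_end[OF le sub])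
    from contracted_class_signed_iso[OF this adm _ V_graph_admissible] show ?thesis
      using num N by (simp add: V_elt_def)
  qed
  let ?f = "\<lambda>i. (-1) ^ i *\<^sub>G ?c i"
  let ?J = "(\<lambda>j. 4 * j + 5) ` {1..<?k}"
  have "gc_boundary (U_elt N S :: 'k gc) = (\<Sum>i<2 * N + 1. ?f i)"
    unfolding U_elt_def gc_boundary_class[OF adm] num by (simp add: power_add power_mult)
  also have "\<dots> = (\<Sum>i\<in>?J \<union> {4 * ?k + 5, 4 * ?k + 6, 2 * N}. ?f i)"
  proof (rule sum.mono_neutral_right)
    show "\<forall>i\<in>{..<2 * N + 1} - (?J \<union> {4 * ?k + 5, 4 * ?k + 6, 2 * N}). ?f i = 0"
    proof
      fix i assume i: "i \<in> {..<2 * N + 1} - (?J \<union> {4 * ?k + 5, 4 * ?k + 6, 2 * N})"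
      have "?c i = 0" unfolding U'
      proof (rule contracted_class_U_zero)
        show "i \<noteq> 4 * j + 5" if "1 \<le> j" "j \<le> ?k" for j
          using i that by (cases "j = ?k") auto
      qed (use i N in auto)
      then show "?f i = 0" by simp
    qed
  qed (use N in auto)
  also have "\<dots> = (\<Sum>i\<in>?J. ?f i) + (\<Sum>i\<in>{4 * ?k + 5, 4 * ?k + 6, 2 * N}. ?f i)"
    by (rule sum.union_disjoint) (use N in auto)
  also have "(\<Sum>i\<in>?J. ?f i) = - (\<Sum>j\<in>{1..<?k}. ?c (4 * j + 5))"
    by (subst sum.reindex) (auto simp: inj_on_def sum_negf power_add power_mult)
  also have "(\<Sum>i\<in>{4 * ?k + 5, 4 * ?k + 6, 2 * N}. ?f i) = ?f (4 * ?k + 5) + (?f (4 * ?k + 6) + ?f (2 * N))"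
    using N by simp
  also have "\<dots> = - V_elt N S + (V_elt N (S @ [Lft]) + V_elt N (S @ [Rgt]))"
    unfolding centre left right by (simp add: power_add power_mult)
  finally show ?thesis by (simp add: algebra_simps)
qed

section \<open>Summation over all sequences\<close>

definition seqs :: "nat \<Rightarrow> side list set" where
  "seqs k = {S. length S = k}"

lemma finite_seqs [simp]: "finite (seqs k)"
proof -
  have "finite {S :: side list. set S \<subseteq> {Lft, Rgt} \<and> length S = k}"
    by (intro finite_lists_length_eq) simp
  moreover have "seqs k \<subseteq> {S. set S \<subseteq> {Lft, Rgt} \<and> length S = k}"
    by (auto simp: seqs_def intro: side.exhaust)
  ultimately show ?thesis by (rule rev_finite_subset)
qed

lemma V_elt_mirror:
  assumes "odd N" "2 * length S + 3 \<le> N"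
  shows "V_elt N (map flip S) = V_elt N S"
proof -
  define r where "r = N - 2 * length S - 3"
  have r: "even r" "N = 3 + 2 * length S + r" using assms by (auto simp: r_def)
  have "signed_iso 1 (V_graph N S) (V_graph N (map flip S))"
  proof -
    have "signed_iso 1 (LGraph {0..N} (start_edges @ grow (V_end r) S 1 2 3 3))
        (LGraph {0..N} (start_edges @ grow (V_end r) (map flip S) 1 2 3 3))"
    proof (rule grow_mirror[OF _ _ r(2)])
      show "map (image h) (V_end r L C R k) = V_end r (h L) (h C) (h R) k"
        if "\<And>v. v > k \<Longrightarrow> h v = v" for h L C R k
        using that by (rule map_image_V_end)
      show "signed_iso 1 (LGraph {0..n + (r)} (es @ V_end r R C L n)) (LGraph {0..n + (r)} (es @ V_end r L C R n))"
        if "L \<le> n" "C \<le> n" "R \<le> n" "\<And>e. e \<in> set es \<Longrightarrow> e \<subseteq> {0..n}" for L C R n es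
        using that r(1) by (rule V_end_mirror)
    qed
    then show ?thesis using assms(2) by (simp add: V_graph_grow r_def)
  qed
  then show ?thesis
    by (simp add: V_elt_def gc_class_signed_iso[of 1 "V_graph N S", OF _ V_graph_admissible V_graph_admissible])
qed

lemma U_elt_mirror:
  assumes "odd N" "2 * length S + 3 < N"
  shows "U_elt N (map flip S) = U_elt N S"
proof -
  define r where "r = N - 2 * length S - 3"
  have r: "even r" "N + 1 = 3 + 2 * length S + (r + 1)" using assms by (auto simp: r_def)
  have "signed_iso 1 (U_graph N S) (U_graph N (map flip S))"
  proof -
    have "signed_iso 1 (LGraph {0..N + 1} (start_edges @ grow (U_end r) S 1 2 3 3))
        (LGraph {0..N + 1} (start_edges @ grow (U_end r) (map flip S) 1 2 3 3))"
    proof (rule grow_mirror[OF _ _ r(2)])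
      show "map (image h) (U_end r L C R k) = U_end r (h L) (h C) (h R) k"
        if "\<And>v. v > k \<Longrightarrow> h v = v" for h L C R k
        using that by (rule map_image_U_end)
      show "signed_iso 1 (LGraph {0..n + (r + 1)} (es @ U_end r R C L n)) (LGraph {0..n + (r + 1)} (es @ U_end r L C R n))"
        if "L \<le> n" "C \<le> n" "R \<le> n" "\<And>e. e \<in> set es \<Longrightarrow> e \<subseteq> {0..n}" for L C R n es
        using that r(1) by (rule U_end_mirror)
    qed
    then show ?thesis using assms(2) by (simp add: U_graph_grow r_def)
  qed
  moreover have "admissible (U_graph N S)" "admissible (U_graph N (map flip S))"
    using U_graph_admissible assms by auto
  ultimately show ?thesis by (simp add: U_elt_def gc_class_signed_iso[of 1 "U_graph N S"])
qed

text \<open>\<open>map flip\<close> is a bijection from the sequences starting with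
  \<open>Lft\<close> to those starting with \<open>Rgt\<close> and preserves \<open>f\<close>;
  \<open>1 \<le> k\<close> provides a first entry.\<close>

lemma sum_left_seqs:
  fixes f :: "side list \<Rightarrow> 'k::field_char_0 gc"
  assumes "1 \<le> k" "\<And>S. length S = k \<Longrightarrow> f (map flip S) = f S"
  shows "2 *\<^sub>G (\<Sum>S\<in>left_seqs k. f S) = (\<Sum>S\<in>seqs k. f S)"
proof -
  let ?R = "map flip ` left_seqs k"
  have hd: "hd (map flip S) = Rgt" if "S \<in> left_seqs k" for S
    using that by (cases S) (auto simp: left_seqs_def)
  have "S \<in> ?R" if "length S = k" "hd S \<noteq> Lft" for S
  proof (rule image_eqI)
    have "hd S = Rgt" using that(2) by (cases "hd S") auto
    then show "map flip S \<in> left_seqs k" using that assms(1) by (cases S) (auto simp: left_seqs_def)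
  qed (simp add: o_def)
  then have "seqs k = left_seqs k \<union> ?R"
    using assms(1) by (auto simp: seqs_def left_seqs_def)
  moreover have "left_seqs k \<inter> ?R = {}"
  proof (rule ccontr)
    assume "left_seqs k \<inter> ?R \<noteq> {}"
    then obtain T where "T \<in> left_seqs k" "map flip T \<in> left_seqs k" by blast
    with hd[of T] show False by (simp add: left_seqs_def)
  qed
  ultimately have "(\<Sum>S\<in>seqs k. f S) = (\<Sum>S\<in>left_seqs k. f S) + (\<Sum>S\<in>?R. f S)"
    by (simp add: sum.union_disjoint finite_left_seqs)
  also have "(\<Sum>S\<in>?R. f S) = (\<Sum>S\<in>left_seqs k. f S)"
  proof -
    have "inj_on (map flip) (left_seqs k)"
      by (rule inj_on_inverseI[of _ "map flip"]) (simp add: o_def)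
    then have "(\<Sum>S\<in>?R. f S) = (\<Sum>S\<in>left_seqs k. f (map flip S))"
      by (simp add: sum.reindex)
    also have "\<dots> = (\<Sum>S\<in>left_seqs k. f S)"
      by (rule sum.cong) (simp_all add: left_seqs_def assms(2))
    finally show ?thesis .
  qed
  finally show ?thesis using gc.scale_left_distrib[of 1 1] by simp
qed

text \<open>The involution \<open>swap_at j\<close> of \<open>seqs k\<close> changes the sign of the
  summand, so the sum equals its own negative.\<close>

lemma sum_contracted_class_zero:
  assumes "odd N" "2 * k + 3 < N" "1 \<le> j" "j < k"
  shows "(\<Sum>S\<in>seqs k. contracted_class (U_graph N S) (4 * j + 5)) = (0 :: 'k::field_char_0 gc)"
proof (rule gc_eq_uminus_self)
  let ?f = "\<lambda>S. contracted_class (U_graph N S) (4 * j + 5) :: 'k gc"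
  have inv: "swap_at j (swap_at j S) = S" "length (swap_at j S) = k" if "length S = k" for S :: "side list"
    using that assms(3,4) by (auto simp: swap_at_def list_eq_iff_nth_eq nth_list_update)
  have "(\<Sum>S\<in>seqs k. ?f S) = (\<Sum>S\<in>seqs k. ?f (swap_at j S))"
    by (rule sum.reindex_bij_witness[of _ "swap_at j" "swap_at j"]) (auto simp: seqs_def inv)
  also have "\<dots> = (\<Sum>S\<in>seqs k. - ?f S)"
    by (rule sum.cong) (use assms contracted_class_U_swap in \<open>auto simp: seqs_def\<close>)
  finally show "(\<Sum>S\<in>seqs k. ?f S) = - (\<Sum>S\<in>seqs k. ?f S)" by (simp add: sum_negf)
qed

lemma sum_seqs_Suc:
  fixes f :: "side list \<Rightarrow> 'b::comm_monoid_add"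
  shows "(\<Sum>S\<in>seqs (Suc k). f S) = (\<Sum>S\<in>seqs k. f (S @ [Lft]) + f (S @ [Rgt]))"
proof -
  let ?A = "\<lambda>s. (\<lambda>S. S @ [s]) ` seqs k"
  have "S \<in> ?A Lft \<union> ?A Rgt" if len: "length S = Suc k" for S
  proof -
    obtain T s where S: "S = T @ [s]" "length T = k"
      using len by (cases S rule: rev_cases) auto
    then show ?thesis by (cases s) (auto simp: seqs_def)
  qed
  then have "seqs (Suc k) = ?A Lft \<union> ?A Rgt" by (auto simp: seqs_def)
  moreover have "?A Lft \<inter> ?A Rgt = {}" by auto
  ultimately have "(\<Sum>S\<in>seqs (Suc k). f S) = (\<Sum>S\<in>?A Lft. f S) + (\<Sum>S\<in>?A Rgt. f S)"
    by (simp add: sum.union_disjoint)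
  also have "\<dots> = (\<Sum>S\<in>seqs k. f (S @ [Lft]) + f (S @ [Rgt]))"
    by (simp add: sum.reindex inj_on_def sum.distrib)
  finally show ?thesis .
qed

lemma gc_boundary_sum_U:
  assumes "odd N" "2 * k + 3 < N"
  shows "gc_boundary (\<Sum>S\<in>seqs k. U_elt N S :: 'k::field_char_0 gc) =
    (\<Sum>S\<in>seqs (Suc k). V_elt N S) - (\<Sum>S\<in>seqs k. V_elt N S)"
proof -
  let ?c = "\<lambda>S j. contracted_class (U_graph N S) (4 * j + 5) :: 'k gc"
  have "gc_boundary (\<Sum>S\<in>seqs k. U_elt N S :: 'k gc) =
      (\<Sum>S\<in>seqs k. V_elt N (S @ [Lft]) + V_elt N (S @ [Rgt]) - V_elt N S - (\<Sum>j\<in>{1..<k}. ?c S j))"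
    unfolding gc_boundary.sum
    by (rule sum.cong) (use assms in \<open>auto simp: seqs_def gc_boundary_U\<close>)
  also have "\<dots> = (\<Sum>S\<in>seqs (Suc k). V_elt N S) - (\<Sum>S\<in>seqs k. V_elt N S) - (\<Sum>S\<in>seqs k. \<Sum>j\<in>{1..<k}. ?c S j)"
    by (simp add: sum_subtractf sum_seqs_Suc)
  \<comment> \<open>The cancellation takes place between different sequences with \<open>j\<close>
    fixed, hence the exchange of sums.\<close>
  also have "(\<Sum>S\<in>seqs k. \<Sum>j\<in>{1..<k}. ?c S j) = (\<Sum>j\<in>{1..<k}. \<Sum>S\<in>seqs k. ?c S j)"
    by (rule sum.swap)
  also have "\<dots> = 0"
    by (rule sum.neutral) (use assms sum_contracted_class_zero in auto)
  finally show ?thesis by simp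
qed

text \<open>At \<open>k = 0\<close> the empty sequence is its own mirror image and counts once,
  which is why this level carries no factor 2.\<close>

lemma U_level_sum:
  assumes "k + 2 \<le> m"
  shows "U_level m k = (\<Sum>S\<in>seqs k. U_elt (2 * m + 1) S)"
proof (cases "k = 0")
  case False
  then show ?thesis
    unfolding U_level_def using assms by (subst sum_left_seqs) (auto simp: U_elt_mirror)
qed (simp add: U_level_def seqs_def)

theorem theorem5p1:
  fixes m :: nat
  assumes "m \<ge> 2"
  shows "(W_elt (2 * m + 1) :: 'k::field_char_0 gc) + gc_boundary (U_total m) =
    2 *\<^sub>G (\<Sum>S\<in>left_seqs (m - 1). V_elt (2 * m + 1) S)"
proof -
  let ?N = "2 * m + 1"
  let ?V = "\<lambda>k. \<Sum>S\<in>seqs k. V_elt ?N S :: 'k gc"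
  have "gc_boundary (U_total m) = (\<Sum>k = 0..m - 2. ?V (Suc k) - ?V k)"
    unfolding U_total_def gc_boundary.sum
    by (rule sum.cong) (use assms in \<open>auto simp: U_level_sum gc_boundary_sum_U\<close>)
  also have "\<dots> = ?V (Suc (m - 2)) - ?V 0" by (rule sum_Suc_diff) simp
  also have "Suc (m - 2) = m - 1" using assms by simp
  also have "?V 0 = W_elt ?N" by (simp add: seqs_def W_elt_def)
  also have "?V (m - 1) = 2 *\<^sub>G (\<Sum>S\<in>left_seqs (m - 1). V_elt ?N S)"
    using assms by (subst sum_left_seqs) (auto simp: V_elt_mirror)
  finally show ?thesis by simp
qed

end
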